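(* Let $n\geq 4$ and let $S$ be a set of $n$ points in $\mathbb{R}^3$. Then the diameter graph on $S$ has at most $2n-2$ edges.
   Context: For a finite set $S$ of points in $\mathbb{R}^d$ (with the Euclidean norm), the diameter $D$ of $S$ is the maximum distance between two points of $S$. The diameter graph on $S$ is the graph with vertex set $S$ in which two distinct points are joined by an edge exactly when they are at distance $D$. *)

theory Defs
  imports "HOL-Analysis.Analysis"
begin

(* The library constant diameter is a supremum; on finite nonempty sets it is the maximum distance. *)
lemma diameter_finite_eq_Max:
  fixes S :: "'a::metric_space set"
  assumes "finite S" and "S \<noteq> {}"
  shows "diameter S = Max {dist x y | x y. x \<in> S \<and> y \<in> S}"
proof -
  have eq: "{dist x y | x y. x \<in> S \<and> y \<in> S} = (\<lambda>(x, y). dist x y) ` (S \<times> S)"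
    by auto
  show ?thesis
    using assms unfolding eq diameter_def by (simp add: cSup_eq_Max)
qed

(* A graph is a pair of a vertex set and a set of edges, each edge an unordered pair of vertices. *)
type_synonym 'a ugraph = "'a set \<times> 'a set set"

abbreviation vertices :: "'a ugraph \<Rightarrow> 'a set" where
  "vertices G \<equiv> fst G"

abbreviation edges :: "'a ugraph \<Rightarrow> 'a set set" where
  "edges G \<equiv> snd G"

definition diameter_graph :: "(real ^ 'd) set \<Rightarrow> (real ^ 'd) ugraph" where
  "diameter_graph S =
     (S, {{x, y} | x y. x \<in> S \<and> y \<in> S \<and> x \<noteq> y \<and> dist x y = diameter S})"

end

theory Submission
  imports Defs
begin

text \<open>
  Scale the diameter to 1 and remove points of degree at most 2, so that all degrees are at least 3.
  Attach to every point \<open>x\<close> the red cone spanned by the directions \<open>y - x\<close> of its edges, and the blue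
  cone opposite to it. As observed by Swanepoel, the red cones are pairwise disjoint, so are the blue
  ones, and the red cone of \<open>x\<close> meets the blue cone of \<open>y\<close> at most in the ray of \<open>y - x\<close>, which is
  extreme in both. On the sphere this is a bipartite contact system of \<open>2n\<close> convex polygons with \<open>2e\<close>
  contacts, and Euler's formula would finish the proof.

  Euler's formula is replaced by a sweep along meridians. The north pole \<open>N\<close> is put generically inside
  one red polygon, so the south pole is inside a blue one. Every other polygon has one leftmost and one
  rightmost contact, which gives \<open>4(n - 1)\<close> extreme incidences in total. A contact at which neither
  polygon is rightmost starts a gap between two polygons that opens to the right. Following this cusp
  up to the first contact inside it leads to a contact where the meridian enters a gap upwards or
  downwards, or where both polygons lie on the right. These targets are distinct, and no target is
  reached both from a cusp on its left and from one on its right, because the gap would be a triangle,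
  whereas the sides of a gap alternate in colour. Comparing the number of cusps with the number of
  targets shows that the \<open>2e\<close> contacts are at most as many as the extreme incidences.
\<close>

section \<open>Determinants and cones\<close>

definition det3 :: "real^3 \<Rightarrow> real^3 \<Rightarrow> real^3 \<Rightarrow> real" where
  "det3 a b c = a$1 * (b$2 * c$3 - b$3 * c$2) - a$2 * (b$1 * c$3 - b$3 * c$1)
     + a$3 * (b$1 * c$2 - b$2 * c$1)"

text \<open>
  Relative to the poles \<open>N\<close> and \<open>- N\<close>, read \<open>dt s a b N > 0\<close> as ``\<open>b\<close> is to the right of \<open>a\<close>'' and, for such
  \<open>a\<close> and \<open>b\<close>, read \<open>dt s a b c > 0\<close> as ``\<open>c\<close> is above the great circle \<open>ab\<close>''. The sign \<open>s\<close> is kept so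
  that replacing \<open>(s, N)\<close> by \<open>(- s, - N)\<close> exchanges above and below, and replacing it by \<open>(- s, N)\<close>
  exchanges left and right.
\<close>

definition dt :: "real \<Rightarrow> real^3 \<Rightarrow> real^3 \<Rightarrow> real^3 \<Rightarrow> real" where
  "dt s a b c = s * det3 a b c"

lemma dt_swap12: "dt s b a c = - dt s a b c"
  and dt_swap23: "dt s a c b = - dt s a b c"
  and dt_swap13: "dt s c b a = - dt s a b c"
  and dt_rotate: "dt s b c a = dt s a b c"
  by (simp_all add: dt_def det3_def algebra_simps)

lemma dt_same [simp]: "dt s a a b = 0" "dt s a b a = 0" "dt s b a a = 0"
  by (simp_all add: dt_def det3_def algebra_simps)

lemma dt_add: "dt s (a + a') b c = dt s a b c + dt s a' b c"
  "dt s a (b + b') c = dt s a b c + dt s a b' c"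
  "dt s a b (c + c') = dt s a b c + dt s a b c'"
  by (simp_all add: dt_def det3_def algebra_simps)

lemma dt_diff: "dt s (a - a') b c = dt s a b c - dt s a' b c"
  "dt s a (b - b') c = dt s a b c - dt s a b' c"
  "dt s a b (c - c') = dt s a b c - dt s a b c'"
  by (simp_all add: dt_def det3_def algebra_simps)

lemma dt_scaleR: "dt s (k *\<^sub>R a) b c = k * dt s a b c"
  "dt s a (k *\<^sub>R b) c = k * dt s a b c"
  "dt s a b (k *\<^sub>R c) = k * dt s a b c"
  by (simp_all add: dt_def det3_def algebra_simps)

lemma dt_minus [simp]: "dt s (- a) b c = - dt s a b c"
  "dt s a (- b) c = - dt s a b c"
  "dt s a b (- c) = - dt s a b c"
  "dt (- s) a b c = - dt s a b c"
  by (simp_all add: dt_def det3_def algebra_simps)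

lemma dt_zero [simp]: "dt s 0 b c = 0" "dt s a 0 c = 0" "dt s a b 0 = 0"
  by (simp_all add: dt_def det3_def)

lemma dt_sum: "dt s (\<Sum>z\<in>A. f z *\<^sub>R z) b c = (\<Sum>z\<in>A. f z * dt s z b c)"
  "dt s a b (\<Sum>z\<in>A. f z *\<^sub>R z) = (\<Sum>z\<in>A. f z * dt s a b z)"
  by (induction A rule: infinite_finite_induct) (simp_all add: dt_add dt_scaleR)

text \<open>The three-term Grassmann-Pluecker relation: it derives one orientation at
  \<open>p\<close> from the others.\<close>

lemma det3_pluecker:
  "det3 p a b * det3 p c d = det3 p a c * det3 p b d - det3 p a d * det3 p b c"
  unfolding det3_def by algebra

lemma dt_pluecker:
  "dt s p a b * dt s p c d = dt s p a c * dt s p b d - dt s p a d * dt s p b c"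
  using arg_cong[OF det3_pluecker[of p a b c d], of "\<lambda>x. s * s * x"]
  by (simp add: dt_def algebra_simps)

text \<open>Cramer's rule for four vectors, two terms on each side. With nonnegative coefficients it
  exhibits a common vector of the cone of \<open>a\<close>, \<open>c\<close> and the cone of
  \<open>b\<close>, \<open>d\<close>: a crossing of two arcs.\<close>

lemma dt_cramer:
  "dt s b c d *\<^sub>R a + dt s a b d *\<^sub>R c = dt s a c d *\<^sub>R b + dt s a b c *\<^sub>R d"
  by (simp add: vec_eq_iff forall_3 dt_def det3_def algebra_simps)

section \<open>Cones generated by finite sets of vectors\<close>

definition nonneg_combos :: "(real^3) set \<Rightarrow> (real^3) set" where
  "nonneg_combos A = {v. \<exists>f. (\<forall>z. 0 \<le> f z) \<and> v = (\<Sum>z\<in>A. f z *\<^sub>R z)}"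

lemma nonneg_combosE:
  assumes "v \<in> nonneg_combos A"
  obtains f where "\<And>z. 0 \<le> f z" "v = (\<Sum>z\<in>A. f z *\<^sub>R z)"
  using assms by (auto simp: nonneg_combos_def)

lemma nonneg_combos_add:
  assumes "v \<in> nonneg_combos A" "w \<in> nonneg_combos A"
  shows "v + w \<in> nonneg_combos A"
proof -
  obtain f g where "\<And>z. 0 \<le> f z" "v = (\<Sum>z\<in>A. f z *\<^sub>R z)"
    "\<And>z. 0 \<le> g z" "w = (\<Sum>z\<in>A. g z *\<^sub>R z)"
    using assms unfolding nonneg_combos_def by blast
  then show ?thesis unfolding nonneg_combos_def
    by (auto intro!: exI[of _ "\<lambda>z. f z + g z"] simp: sum.distrib scaleR_add_left)
qed

lemma nonneg_combos_scaleR: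
  assumes "v \<in> nonneg_combos A" "0 \<le> k"
  shows "k *\<^sub>R v \<in> nonneg_combos A"
proof -
  obtain f where "\<And>z. 0 \<le> f z" "v = (\<Sum>z\<in>A. f z *\<^sub>R z)"
    using assms unfolding nonneg_combos_def by blast
  then show ?thesis unfolding nonneg_combos_def using assms
    by (auto intro!: exI[of _ "\<lambda>z. k * f z"] simp: scaleR_sum_right)
qed

lemma nonneg_combos_member:
  assumes "finite A" "z \<in> A"
  shows "z \<in> nonneg_combos A"
proof -
  have "(\<Sum>y\<in>A. (if y = z then 1 else 0) *\<^sub>R y) = z"
    using assms by (simp add: if_distrib[of "\<lambda>k. k *\<^sub>R _"] cong: if_cong)
  then show ?thesis unfolding nonneg_combos_def
    by (auto intro!: exI[of _ "\<lambda>y. if y = z then 1 else 0"])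
qed

lemma nonneg_combos_zero: "0 \<in> nonneg_combos A"
  unfolding nonneg_combos_def by (auto intro!: exI[of _ "\<lambda>_. 0"])

lemma ex_arg_min:
  fixes f :: "'a \<Rightarrow> real"
  assumes "finite A" "A \<noteq> {}"
  obtains a where "a \<in> A" "\<And>b. b \<in> A \<Longrightarrow> f a \<le> f b"
  using assms by (metis arg_min_if_finite(1) arg_min_least)

section \<open>Arrangements of red and blue cones\<close>

text \<open>Where this fails, \<open>p\<close> is the rightmost vertex of its polygon, or the
  leftmost one if \<open>s\<close> is negated: an extreme incidence.\<close>

definition right_nbr :: "real \<Rightarrow> real^3 \<Rightarrow> (bool \<Rightarrow> real^3 \<Rightarrow> (real^3) set) \<Rightarrow> bool \<Rightarrow> real^3 \<Rightarrow> bool" where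
  "right_nbr s N cls c p \<longleftrightarrow> (\<exists>z\<in>cls c p. dt s p z N > 0)"

text \<open>The meridian through \<open>p\<close> runs into the polygon \<open>cls c p\<close> immediately below \<open>p\<close>.\<close>

definition covers_below :: "real \<Rightarrow> real^3 \<Rightarrow> (bool \<Rightarrow> real^3 \<Rightarrow> (real^3) set) \<Rightarrow> bool \<Rightarrow> real^3 \<Rightarrow> bool" where
  "covers_below s N cls c p \<longleftrightarrow>
    (\<exists>u\<in>cls c p. \<exists>v\<in>cls c p. dt s p u N > 0 \<and> dt s p v N < 0 \<and> dt s p u v < 0)"

text \<open>
  \<open>P\<close> is the set of contacts, and \<open>cls c p\<close> is the vertex set of the polygon of colour \<open>c\<close> that has the
  vertex \<open>p\<close>.
\<close>

locale arrangement =
  fixes s :: real and N :: "real^3" and P :: "(real^3) set"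
    and cls :: "bool \<Rightarrow> real^3 \<Rightarrow> (real^3) set"
  assumes finite_P: "finite P"
    and generic: "\<lbrakk>p \<in> P; q \<in> P; dt s p q N = 0\<rbrakk> \<Longrightarrow> q = p \<or> q = - p"
    and cls_subset: "p \<in> P \<Longrightarrow> cls c p \<subseteq> P"
    and cls_refl: "p \<in> P \<Longrightarrow> p \<in> cls c p"
    and cls_eq: "\<lbrakk>p \<in> P; z \<in> cls c p\<rbrakk> \<Longrightarrow> cls c z = cls c p"
    and cls_meet: "\<lbrakk>p \<in> P; z \<in> cls c p; z \<in> cls (\<not> c) p\<rbrakk> \<Longrightarrow> z = p"
    and cls_nontrivial: "p \<in> P \<Longrightarrow> \<exists>z\<in>cls c p. z \<noteq> p"
    and same_colour: "\<lbrakk>p \<in> P; q \<in> P; v \<in> nonneg_combos (cls c p); v \<in> nonneg_combos (cls c q); v \<noteq> 0\<rbrakk>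
      \<Longrightarrow> cls c p = cls c q"
    and different_colour: "\<lbrakk>p \<in> P; q \<in> P; v \<in> nonneg_combos (cls c p); v \<in> nonneg_combos (cls (\<not> c) q); v \<noteq> 0\<rbrakk>
      \<Longrightarrow> \<exists>r\<in>cls c p \<inter> cls (\<not> c) q. \<exists>k. v = k *\<^sub>R r"
    and extreme: "\<lbrakk>p \<in> P; z \<in> cls c p; z \<noteq> p; l > 0; m \<in> nonneg_combos (cls c p); l *\<^sub>R z + m = k *\<^sub>R p\<rbrakk>
      \<Longrightarrow> False"
begin

abbreviation om :: "real^3 \<Rightarrow> real^3 \<Rightarrow> real" where
  "om a b \<equiv> dt s a b N"

text \<open>\<open>s\<close> and \<open>N\<close> enter the axioms only through the vanishing of
  \<open>dt s p q N\<close>, which both reflections preserve. Interpreting the locale with reflected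
  data yields mirror images of its lemmas.\<close>

lemma flip_vertical: "arrangement (- s) (- N) P cls"
  unfolding arrangement_def dt_minus minus_minus neg_equal_0_iff_equal
  by (rule arrangement_axioms[unfolded arrangement_def])

lemma flip_horizontal: "arrangement (- s) N P cls"
  unfolding arrangement_def dt_minus minus_minus neg_equal_0_iff_equal
  by (rule arrangement_axioms[unfolded arrangement_def])

lemma finite_cls: "p \<in> P \<Longrightarrow> finite (cls c p)"
  using cls_subset finite_P finite_subset by blast

lemma cls_in_P: "\<lbrakk>p \<in> P; z \<in> cls c p\<rbrakk> \<Longrightarrow> z \<in> P"
  using cls_subset by blast

lemma cls_combos: "\<lbrakk>p \<in> P; z \<in> cls c p\<rbrakk> \<Longrightarrow> z \<in> nonneg_combos (cls c p)"
  using finite_cls nonneg_combos_member by blast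

lemma combo2:
  assumes "p \<in> P" "u \<in> cls c p" "v \<in> cls c p" "0 \<le> a" "0 \<le> b"
  shows "a *\<^sub>R u + b *\<^sub>R v \<in> nonneg_combos (cls c p)"
  using assms by (auto intro!: nonneg_combos_add nonneg_combos_scaleR intro: cls_combos)

lemma minus_notin_cls: "p \<in> P \<Longrightarrow> - p \<notin> cls c p"
proof
  assume p: "p \<in> P" "- p \<in> cls c p"
  obtain z where z: "z \<in> cls c p" "z \<noteq> p" using cls_nontrivial p by blast
  have "p \<noteq> 0"
  proof
    assume "p = 0"
    then show False
      using extreme[of z p c 1 0 0] z p cls_in_P[OF p(1)] cls_eq[OF p(1) z(1)] cls_refl[OF p(1)]
        nonneg_combos_zero by auto
  qed
  then have "- p \<noteq> p" by (auto simp: vec_eq_iff)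
  then show False
    using extreme[of p "- p" c 1 0 "-1"] p nonneg_combos_zero by simp
qed

lemma om_nonzero:
  assumes "p \<in> P" "q \<in> cls c p" "q \<noteq> p"
  shows "om p q \<noteq> 0"
  using assms generic[of p q] minus_notin_cls[of p c] cls_in_P by blast

text \<open>Modulo the line of \<open>p\<close>, the angles of the two polygons at \<open>p\<close>
  share only the apex: a common vector is a multiple of a shared vertex, which is \<open>p\<close>
  by \<open>cls_meet\<close>, and \<open>extreme\<close> excludes that.\<close>

lemma local_disjoint:
  assumes p: "p \<in> P" and u: "u \<in> cls c p" "u \<noteq> p" and l: "l > 0"
    and m: "m \<in> nonneg_combos (cls c p)" and y: "y \<in> nonneg_combos (cls (\<not> c) p)"
    and eq: "l *\<^sub>R u + m = y + k *\<^sub>R p"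
  shows False
proof -
  \<comment> \<open>The multiple of \<open>p\<close> goes to the side where its coefficient is
    nonnegative, so that both sides stay in their cones.\<close>
  define m' where "m' = m + max 0 (- k) *\<^sub>R p"
  have m': "m' \<in> nonneg_combos (cls c p)"
    unfolding m'_def using p m by (auto intro!: nonneg_combos_add nonneg_combos_scaleR intro: cls_combos cls_refl)
  have v: "l *\<^sub>R u + m' = y + max 0 k *\<^sub>R p"
    unfolding m'_def using eq by (auto simp: max_def algebra_simps)
  have "l *\<^sub>R u + m' \<in> nonneg_combos (cls c p)"
    using p u l m' by (auto intro!: nonneg_combos_add nonneg_combos_scaleR intro: cls_combos)
  moreover have "l *\<^sub>R u + m' \<in> nonneg_combos (cls (\<not> c) p)"
    unfolding v using p y by (auto intro!: nonneg_combos_add nonneg_combos_scaleR intro: cls_combos cls_refl)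
  moreover have "l *\<^sub>R u + m' \<noteq> 0"
    using extreme[OF p u l m', of 0] by auto
  ultimately obtain r j where "r \<in> cls c p" "r \<in> cls (\<not> c) p" "l *\<^sub>R u + m' = j *\<^sub>R r"
    using different_colour[OF p p] by blast
  then show False
    using extreme[OF p u l m'] cls_meet[OF p] by blast
qed

text \<open>Such a \<open>v\<close> would point into the angle between \<open>u\<close> and
  \<open>u'\<close>, which the other polygon occupies.\<close>

lemma local_between:
  assumes p: "p \<in> P" and u: "u \<in> cls c p" "u' \<in> cls c p" and v: "v \<in> cls (\<not> c) p" "v \<noteq> p"
    and "dt s p u u' > 0" "dt s p v u' \<ge> 0" "dt s p u v \<ge> 0"
  shows False
proof (rule local_disjoint[OF p v])
  show "dt s p u u' > 0" by fact
  show "0 \<in> nonneg_combos (cls (\<not> c) p)" by (rule nonneg_combos_zero)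
  show "dt s p v u' *\<^sub>R u + dt s p u v *\<^sub>R u' \<in> nonneg_combos (cls (\<not> \<not> c) p)"
    using assms by (simp add: combo2)
  show "dt s p u u' *\<^sub>R v + 0 = (dt s p v u' *\<^sub>R u + dt s p u v *\<^sub>R u') + dt s v u u' *\<^sub>R p"
    using dt_cramer[of s p u u' v] dt_swap12[of s v p u'] dt_rotate[of s v p u] dt_rotate[of s p u v]
    by (simp add: algebra_simps)
qed

lemma extreme2:
  assumes "p \<in> P" "u \<in> cls c p" "v \<in> cls c p" "u \<noteq> p" "a > 0" "b \<ge> 0"
  shows "a *\<^sub>R u + b *\<^sub>R v \<noteq> k *\<^sub>R p"
  using extreme[of p u c a "b *\<^sub>R v" k] assms nonneg_combos_scaleR cls_combos by blast

text \<open>For any signs of \<open>b\<close> and \<open>k\<close>, moving terms writes a multiple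
  of one of \<open>p\<close>, \<open>u\<close>, \<open>v\<close> as a nonnegative combination of the
  other two, against extremality of that vertex.\<close>

lemma extreme2_le:
  assumes p: "p \<in> P" and u: "u \<in> cls c p" "v \<in> cls c p" "u \<noteq> p" "v \<noteq> p" "u \<noteq> v" and "a > 0"
  shows "a *\<^sub>R u \<noteq> b *\<^sub>R v + k *\<^sub>R p"
proof
  assume eq: "a *\<^sub>R u = b *\<^sub>R v + k *\<^sub>R p"
  have cu: "u \<in> P" "cls c u = cls c p" and cv: "v \<in> P" "cls c v = cls c p"
    using p u cls_in_P cls_eq by blast+
  consider "b \<le> 0" | "b > 0" "k \<ge> 0" | "b > 0" "k < 0" by linarith
  then show False
  proof cases
    case 1
    then show ?thesis
      using extreme2[OF p u(1,2,3) assms(7), of "- b" k] eq by simp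
  next
    case 2
    then show ?thesis
      using extreme2[OF cu(1), of v c p b k a] cu cv u eq cls_refl[OF p] by simp
  next
    case 3
    then show ?thesis
      using extreme2[OF cv(1), of u c p a "- k" b] cu cv u eq cls_refl[OF p] assms(7) by simp
  qed
qed

text \<open>If the determinant vanished, \<open>dt_cramer\<close> with \<open>N\<close> would lose
  its \<open>N\<close> term and become a relation between three vertices, as excluded by
  \<open>extreme2_le\<close>.\<close>

lemma dt_cls_nonzero:
  assumes p: "p \<in> P" and u: "u \<in> cls c p" "v \<in> cls c p" "u \<noteq> p" "v \<noteq> p" "u \<noteq> v"
  shows "dt s p u v \<noteq> 0"
proof
  assume 0: "dt s p u v = 0"
  have eq: "om p v *\<^sub>R u = om p u *\<^sub>R v + om u v *\<^sub>R p"
    using dt_cramer[of s p v N u] 0 by (simp add: dt_swap12[of s u p] algebra_simps)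
  have "om p v \<noteq> 0" using om_nonzero p u by blast
  then consider "om p v > 0" | "- om p v > 0" by linarith
  then show False
  proof cases
    case 1
    then show ?thesis using extreme2_le[OF p u 1] eq by blast
  next
    case 2
    show ?thesis using extreme2_le[OF p u 2, of "- om p u" "- om u v"] eq by (simp add: algebra_simps)
  qed
qed

text \<open>The vector form of covering: modulo \<open>p\<close>, the direction \<open>- N\<close>
  lies in the cone of the polygon. The coefficients come from \<open>dt_cramer\<close>.\<close>

lemma covers_belowE:
  assumes p: "p \<in> P" and "covers_below s N cls c p"
  obtains u m l d k where "u \<in> cls c p" "u \<noteq> p" "l > 0" "m \<in> nonneg_combos (cls c p)" "d > 0"
    "l *\<^sub>R u + m = k *\<^sub>R p - d *\<^sub>R N"
proof -
  obtain u v where uv: "u \<in> cls c p" "v \<in> cls c p" "om p u > 0" "om p v < 0" "dt s p u v < 0"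
    using assms unfolding covers_below_def by blast
  show thesis
  proof
    show "u \<in> cls c p" "u \<noteq> p" "- om p v > 0" "- dt s p u v > 0" using uv by auto
    show "om p u *\<^sub>R v \<in> nonneg_combos (cls c p)"
      using uv p by (auto intro: nonneg_combos_scaleR cls_combos)
    show "(- om p v) *\<^sub>R u + om p u *\<^sub>R v = (- om u v) *\<^sub>R p - (- dt s p u v) *\<^sub>R N"
      using dt_cramer[of s p v N u] dt_swap12[of s u p N] dt_swap12[of s u p v]
      by (simp add: algebra_simps)
  qed
qed

lemma not_covers_below_both_colours:
  assumes p: "p \<in> P" and "covers_below s N cls c p" "covers_below s N cls (\<not> c) p"
  shows False
proof -
  obtain u m l d k where 1: "u \<in> cls c p" "u \<noteq> p" "l > 0" "m \<in> nonneg_combos (cls c p)" "d > 0"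
    "l *\<^sub>R u + m = k *\<^sub>R p - d *\<^sub>R N"
    using covers_belowE assms by metis
  obtain u' m' l' d' k' where 2: "u' \<in> cls (\<not> c) p" "u' \<noteq> p" "l' > 0"
    "m' \<in> nonneg_combos (cls (\<not> c) p)" "d' > 0" "l' *\<^sub>R u' + m' = k' *\<^sub>R p - d' *\<^sub>R N"
    using covers_belowE assms by metis
  show False
  proof (rule local_disjoint[OF p 1(1,2)])
    show "d' * l > 0" using 1 2 by simp
    show "d' *\<^sub>R m \<in> nonneg_combos (cls c p)" using 1 2 by (simp add: nonneg_combos_scaleR)
    show "d *\<^sub>R (l' *\<^sub>R u' + m') \<in> nonneg_combos (cls (\<not> c) p)"
      using 1(1-5) 2(1-5) p by (auto intro!: nonneg_combos_add nonneg_combos_scaleR intro: cls_combos)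
    show "(d' * l) *\<^sub>R u + d' *\<^sub>R m = d *\<^sub>R (l' *\<^sub>R u' + m') + (d' * k - d * k') *\<^sub>R p"
      using arg_cong[OF 1(6), of "\<lambda>x. d' *\<^sub>R x"] unfolding 2(6) by (simp add: algebra_simps)
  qed
qed

text \<open>The determinant of a right and a left neighbour is nonzero, and its sign decides whether
  their angle contains the downward or the upward meridian.\<close>

lemma covers_below_or_above:
  assumes p: "p \<in> P" and "right_nbr s N cls c p" "right_nbr (- s) N cls c p"
  shows "covers_below s N cls c p \<or> covers_below (- s) (- N) cls c p"
proof -
  obtain u v where uv: "u \<in> cls c p" "v \<in> cls c p" "om p u > 0" "om p v < 0"
    using assms unfolding right_nbr_def by auto
  then have "dt s p u v \<noteq> 0"
    by (intro dt_cls_nonzero[OF p]) auto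
  with uv show ?thesis
    unfolding covers_below_def by (auto simp: not_less linorder_neq_iff)
qed

end

section \<open>Cusps and their targets\<close>

definition wedge :: "real \<Rightarrow> real^3 \<Rightarrow> (real^3) set \<Rightarrow> real^3 \<Rightarrow> real^3 \<Rightarrow> real^3 \<Rightarrow> (real^3) set" where
  "wedge s N P p q q' = {z \<in> P. dt s p z N > 0 \<and> dt s p q' z \<ge> 0 \<and> dt s p q z \<le> 0}"

text \<open>
  At \<open>p\<close> a gap opens to the right, between the edge \<open>pq\<close> of the polygon of colour \<open>c\<close> above it and the
  edge \<open>pq'\<close> of the other polygon below it; \<open>w\<close> is the first contact met when sweeping to the right.
  The wedge is unbounded on the right, but it contains \<open>q\<close> and \<open>q'\<close>, so \<open>w\<close> is not beyond them.
\<close>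

definition cusp :: "real \<Rightarrow> real^3 \<Rightarrow> (real^3) set \<Rightarrow> (bool \<Rightarrow> real^3 \<Rightarrow> (real^3) set) \<Rightarrow> bool
    \<Rightarrow> real^3 \<Rightarrow> real^3 \<Rightarrow> real^3 \<Rightarrow> real^3 \<Rightarrow> bool" where
  "cusp s N P cls c p q q' w \<longleftrightarrow> p \<in> P \<and> q \<in> cls c p \<and> q' \<in> cls (\<not> c) p
    \<and> dt s p q N > 0 \<and> dt s p q' N > 0 \<and> dt s p q' q > 0
    \<and> (\<forall>z\<in>cls c p. z \<noteq> p \<longrightarrow> z \<noteq> q \<longrightarrow> dt s p q z > 0)
    \<and> (\<forall>z\<in>cls (\<not> c) p. z \<noteq> p \<longrightarrow> z \<noteq> q' \<longrightarrow> dt s p q' z < 0)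
    \<and> w \<in> wedge s N P p q q' \<and> (\<forall>z\<in>wedge s N P p q q'. z \<noteq> w \<longrightarrow> dt s w z N > 0)"

lemma wedge_flip: "wedge (- s) (- N) P p q' q = wedge s N P p q q'"
  by (auto simp: wedge_def)

lemma cusp_flip: "cusp (- s) (- N) P cls (\<not> c) p q' q w \<longleftrightarrow> cusp s N P cls c p q q' w"
  unfolding cusp_def wedge_flip by (auto simp: dt_swap23[of _ p q q'])

text \<open>The arc from \<open>m\<close> to \<open>z\<close> starts on or above the great circle
  \<open>pq'\<close> and ends below it; the meridian conditions place the crossing between
  \<open>p\<close> and \<open>q'\<close>. If \<open>m\<close> is on that circle, \<open>m\<close>
  itself is the crossing and \<open>l\<close> is 0.\<close>

lemma cross_low:
  assumes q': "dt s p q' N > 0" and m: "dt s p m N > 0" "dt s m q' N \<ge> 0" "dt s p q' m \<ge> 0"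
    and z: "dt s m z N < 0" "dt s p q' z < 0" "dt s p z N \<ge> 0 \<or> dt s p m z \<le> 0"
    and strict: "dt s p q' m > 0 \<or> dt s m q' N > 0"
  obtains a b l k where "a > 0" "b \<ge> 0" "l \<ge> 0" "dt s p q' m > 0 \<Longrightarrow> l > 0" "k > 0"
    "a *\<^sub>R p + b *\<^sub>R q' = l *\<^sub>R z + k *\<^sub>R m"
proof -
  define a b l k where "a = dt s q' m z" and "b = - dt s p m z" and "l = dt s p q' m"
    and "k = - dt s p q' z"
  have eq: "a *\<^sub>R p + b *\<^sub>R q' = l *\<^sub>R z + k *\<^sub>R m"
    unfolding a_def b_def l_def k_def using dt_cramer[of s q' m z p]
    by (simp add: algebra_simps)
  have lk: "l \<ge> 0" "k > 0" using m z by (auto simp: l_def k_def)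
  \<comment> \<open>Applying \<open>dt s p _ N\<close> and later \<open>dt s _ m N\<close> to the
    relation isolates \<open>b\<close> and \<open>a\<close>, whose signs can then be read
    off.\<close>
  have bq: "b * dt s p q' N = l * dt s p z N + k * dt s p m N"
    using arg_cong[OF eq, of "\<lambda>x. dt s p x N"] by (simp add: dt_add dt_scaleR)
  have zm: "dt s z m N > 0" using z(1) dt_swap12[of s z m N] by simp
  have "b \<ge> 0 \<and> (b > 0 \<or> l > 0)"
  proof (cases "l = 0 \<or> dt s p z N \<ge> 0")
    case True
    then have "b * dt s p q' N > 0"
      unfolding bq using lk m(1) by (auto intro: add_nonneg_pos)
    then show ?thesis using q' by (simp add: zero_less_mult_iff)
  next
    case False
    then show ?thesis using z(3) lk by (simp add: b_def)
  qed
  then have b: "b \<ge> 0" "b > 0 \<or> l > 0" by auto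
  have am: "a * dt s p m N = l * dt s z m N + b * dt s m q' N"
    using arg_cong[OF eq, of "\<lambda>x. dt s x m N"] dt_swap12[of s q' m N]
    by (simp add: dt_add dt_scaleR)
  have "a * dt s p m N > 0"
  proof (cases "l > 0")
    case True
    then show ?thesis unfolding am using zm b m by (intro add_pos_nonneg) auto
  next
    case False
    then have "b > 0" "dt s m q' N > 0" using b strict by (auto simp: l_def)
    then show ?thesis unfolding am using zm lk by (intro add_nonneg_pos) auto
  qed
  then have "a > 0" using m by (simp add: zero_less_mult_iff)
  then show thesis using that[of a b l k] b lk eq by (auto simp: l_def)
qed

lemma cross_high:
  assumes "dt s p q N > 0" "dt s p m N > 0" "dt s m q N \<ge> 0" "dt s p q m \<le> 0"
    and "dt s m z N < 0" "dt s p q z > 0" "dt s p z N \<ge> 0 \<or> dt s p m z \<ge> 0"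
    and "dt s p q m < 0 \<or> dt s m q N > 0"
  obtains a b l k where "a > 0" "b \<ge> 0" "l \<ge> 0" "dt s p q m < 0 \<Longrightarrow> l > 0" "k > 0"
    "a *\<^sub>R p + b *\<^sub>R q = l *\<^sub>R z + k *\<^sub>R m"
  using cross_low[of "- s" p q "- N" m z thesis] assms by simp

text \<open>To the right of \<open>p\<close> the circle \<open>pm\<close> is above
  \<open>pq'\<close>, so to the left it is below. This supplies a hypothesis of
  \<open>cross_low\<close> when \<open>z\<close> is left of \<open>p\<close>.\<close>

lemma left_low:
  assumes "dt s p m N > 0" "dt s p q' N > 0" "dt s p q' m > 0" "dt s p z N < 0" "dt s p m z \<le> 0"
  shows "dt s p q' z < 0"
proof -
  have "dt s p q' m * dt s p z N < 0" using assms by (simp add: mult_pos_neg)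
  moreover have "dt s p q' N * dt s p z m \<ge> 0" using assms dt_swap23[of s p z m] by (simp add: mult_nonneg_nonpos)
  ultimately have "dt s p q' z * dt s p m N < 0" using dt_pluecker[of s p q' z m N] by simp
  then show ?thesis using assms by (simp add: mult_less_0_iff)
qed

lemma left_high:
  assumes "dt s p m N > 0" "dt s p q N > 0" "dt s p q m < 0" "dt s p z N < 0" "dt s p m z \<ge> 0"
  shows "dt s p q z > 0"
  using left_low[of "- s" p m "- N" q z] assms by simp

context arrangement
begin

lemma P_nonzero: "p \<in> P \<Longrightarrow> p \<noteq> 0"
  using minus_notin_cls cls_refl by fastforce

lemma cls_sym: "\<lbrakk>p \<in> P; z \<in> cls c p\<rbrakk> \<Longrightarrow> p \<in> cls c z"
  using cls_eq cls_refl by blast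

lemma om_nonzero_P: "\<lbrakk>p \<in> P; q \<in> P; q \<noteq> p; q \<noteq> - p\<rbrakk> \<Longrightarrow> om p q \<noteq> 0"
  using generic by blast

text \<open>Edges do not cross foreign polygons. If the colours differed, the common vector would be
  a multiple of a contact; the positive weight of \<open>p\<close> forces that contact to be
  \<open>p\<close>, and then the positive weight of \<open>z\<close> contradicts
  \<open>extreme\<close>.\<close>

lemma crossing:
  assumes p: "p \<in> P" and q: "q \<in> cls c p" and y: "y \<in> P" and z: "z \<in> cls d y" "z \<noteq> p"
    and n: "n \<in> nonneg_combos (cls d y)"
    and l: "l > 0" and ab: "a > 0" "b \<ge> 0" and eq: "a *\<^sub>R p + b *\<^sub>R q = l *\<^sub>R z + n"
  shows "c = d \<and> cls c p = cls d y"
proof -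
  define v where "v = a *\<^sub>R p + b *\<^sub>R q"
  have v1: "v \<in> nonneg_combos (cls c p)"
    unfolding v_def using p q ab cls_refl combo2 by simp
  have v2: "v \<in> nonneg_combos (cls d y)"
    unfolding v_def eq using y z n l by (auto intro!: nonneg_combos_add nonneg_combos_scaleR intro: cls_combos)
  have v0: "v \<noteq> 0"
  proof
    assume 0: "v = 0"
    show False
    proof (cases "q = p \<or> b = 0")
      case True
      then have "\<exists>k>0. v = k *\<^sub>R p"
        using ab unfolding v_def
        by (auto simp: scaleR_add_left[symmetric] intro: exI[of _ a] exI[of _ "a + b"])
      then show False using 0 P_nonzero[OF p] by auto
    next
      case False
      then have "b *\<^sub>R q + 0 = (- a) *\<^sub>R p" "b > 0" "q \<noteq> p"
        using 0 ab unfolding v_def by (auto simp: eq_neg_iff_add_eq_0 add.commute)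
      then show False using extreme[OF p q] nonneg_combos_zero by blast
    qed
  qed
  have "c = d"
  proof (rule ccontr)
    assume "c \<noteq> d"
    then have d: "d = (\<not> c)" by auto
    obtain r k where r: "r \<in> cls c p" "r \<in> cls (\<not> c) y" "v = k *\<^sub>R r"
      using different_colour[OF p y v1 v2[unfolded d] v0] by blast
    have rP: "r \<in> P" "cls c r = cls c p" using r p cls_in_P cls_eq by blast+
    have "r = p"
    proof (rule ccontr)
      assume "r \<noteq> p"
      moreover have "b *\<^sub>R q \<in> nonneg_combos (cls c r)"
        unfolding rP(2) using p q ab by (auto intro: nonneg_combos_scaleR cls_combos)
      ultimately show False
        using extreme[OF rP(1), of p c a "b *\<^sub>R q" k] r(3) ab cls_refl[OF p] rP by (auto simp: v_def)
    qed
    then have "cls d p = cls d y" using r(2) d y cls_eq by blast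
    then show False
      using extreme[OF p, of z d l n k] z n l eq r(3) \<open>r = p\<close> v_def by auto
  qed
  moreover have "cls c p = cls c y"
    using same_colour[OF p y v1 _ v0] v2 calculation by blast
  ultimately show ?thesis by blast
qed

lemma cuspD:
  assumes "cusp s N P cls c p q q' w"
  shows "p \<in> P" "q \<in> cls c p" "q' \<in> cls (\<not> c) p" "om p q > 0" "om p q' > 0" "dt s p q' q > 0"
    "\<And>z. \<lbrakk>z \<in> cls c p; z \<noteq> p; z \<noteq> q\<rbrakk> \<Longrightarrow> dt s p q z > 0"
    "\<And>z. \<lbrakk>z \<in> cls (\<not> c) p; z \<noteq> p; z \<noteq> q'\<rbrakk> \<Longrightarrow> dt s p q' z < 0"
    "\<And>z. z \<in> cls c p \<Longrightarrow> dt s p q z \<ge> 0" "\<And>z. z \<in> cls (\<not> c) p \<Longrightarrow> dt s p q' z \<le> 0"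
    "q \<in> P" "q' \<in> P" "w \<in> P" "q \<noteq> p" "q' \<noteq> p" "q \<noteq> q'"
    "om p w > 0" "dt s p q' w \<ge> 0" "dt s p q w \<le> 0"
    "w \<noteq> q \<Longrightarrow> om w q > 0" "w \<noteq> q' \<Longrightarrow> om w q' > 0"
    "\<And>z. \<lbrakk>z \<in> P; om w z < 0; om p z > 0\<rbrakk> \<Longrightarrow> dt s p q' z < 0 \<or> dt s p q z > 0"
proof -
  note d = assms[unfolded cusp_def wedge_def]
  show 1: "p \<in> P" "q \<in> cls c p" "q' \<in> cls (\<not> c) p" "om p q > 0" "om p q' > 0" "dt s p q' q > 0"
    using d by auto
  show 2: "q \<in> P" "q' \<in> P" "w \<in> P" using 1 d cls_in_P by auto
  show "q \<noteq> p" "q' \<noteq> p" using 1 by auto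
  then show "q \<noteq> q'" using 1 cls_meet by blast
  have 3: "dt s p q q' \<le> 0" using 1(6) dt_swap23[of s p q q'] by simp
  show "om p w > 0" "dt s p q' w \<ge> 0" "dt s p q w \<le> 0" using d by auto
  show "w \<noteq> q \<Longrightarrow> om w q > 0" "w \<noteq> q' \<Longrightarrow> om w q' > 0"
    using d 1 2 3 by (auto simp: less_imp_le)
  show "dt s p q z > 0" if "z \<in> cls c p" "z \<noteq> p" "z \<noteq> q" for z using d that by auto
  then show "dt s p q z \<ge> 0" if "z \<in> cls c p" for z
    using that by (cases "z = p \<or> z = q") (auto simp: less_imp_le)
  show "dt s p q' z < 0" if "z \<in> cls (\<not> c) p" "z \<noteq> p" "z \<noteq> q'" for z using d that by auto
  then show "dt s p q' z \<le> 0" if "z \<in> cls (\<not> c) p" for z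
    using that by (cases "z = p \<or> z = q'") (auto simp: less_imp_le)
  show "dt s p q' z < 0 \<or> dt s p q z > 0" if "z \<in> P" "om w z < 0" "om p z > 0" for z
    using d that by (metis (mono_tags, lifting) dt_same(1) less_irrefl linorder_not_le mem_Collect_eq
        order_less_asym)
qed

text \<open>The arc from \<open>w\<close> to \<open>z\<close> would leave the wedge through the
  lower edge. By \<open>crossing\<close>, \<open>w\<close> would be a vertex of the lower polygon,
  but these lie on or below the circle of that edge.\<close>

lemma blocked_low:
  assumes cusp: "cusp s N P cls c p q q' w" and w: "dt s p q' w > 0"
    and z: "z \<in> cls d w" "om w z < 0"
    and low: "om p z \<ge> 0 \<and> dt s p q' z < 0 \<or> om p z < 0 \<and> dt s p w z \<le> 0"
  shows False
proof -
  note e = cuspD[OF cusp]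
  have wq': "w \<noteq> q'" using w by auto
  have "dt s p q' z < 0" using low left_low[OF e(17,5) w] by blast
  then obtain a b l k where *: "a > 0" "b \<ge> 0" "l \<ge> 0" "k > 0"
    "a *\<^sub>R p + b *\<^sub>R q' = l *\<^sub>R z + k *\<^sub>R w"
    using cross_low[of s p q' N w z thesis] e(5,17) e(21)[OF wq'] w z low by force
  have "(\<not> c) = d \<and> cls (\<not> c) p = cls d w"
  proof (rule crossing)
    show "a *\<^sub>R p + b *\<^sub>R q' = k *\<^sub>R w + l *\<^sub>R z" using * by simp
    show "l *\<^sub>R z \<in> nonneg_combos (cls d w)"
      using * e(13) z by (auto intro: nonneg_combos_scaleR cls_combos)
  qed (use * e cls_refl in auto)
  then have "w \<in> cls (\<not> c) p" using e cls_refl by blast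
  then show False using e(10) w by force
qed

text \<open>No contact of the wedge precedes \<open>q\<close>, so a left neighbour not above
  \<open>pq\<close> would have to be reached through the lower edge, against
  \<open>blocked_low\<close>.\<close>

lemma no_entry:
  assumes cusp: "cusp s N P cls c p q q' q" and z: "z \<in> cls (\<not> c) q" "om q z < 0"
  shows "dt s p q z > 0"
proof (rule ccontr)
  note e = cuspD[OF cusp]
  assume neg: "\<not> ?thesis"
  have zP: "z \<in> P" using z e(11) cls_in_P by blast
  have "p \<notin> cls (\<not> c) q"
    using cls_sym[of q p "\<not> c"] cls_meet[of p q c] e by blast
  then have "z \<noteq> p" using z by blast
  moreover have "z \<noteq> - p"
    using z e(4) dt_swap12[of s q p N] by auto
  ultimately have "om p z \<noteq> 0" using om_nonzero_P e(1) zP by blast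
  moreover have "om p z > 0 \<Longrightarrow> dt s p q' z < 0" using e(22)[OF zP z(2)] neg by auto
  ultimately show False using blocked_low[OF cusp e(6) z] neg by linarith
qed

text \<open>The edge \<open>pq\<close> supports its polygon from below, so the meridian leaves that
  polygon at \<open>q\<close>.\<close>

lemma edge_gap_same:
  assumes cusp: "cusp s N P cls c p q q' q"
  shows "\<not> covers_below s N cls c q"
proof
  note d = cuspD[OF cusp]
  assume "covers_below s N cls c q"
  then obtain u v where uv: "u \<in> cls c q" "v \<in> cls c q" "om q u > 0" "om q v < 0" "dt s q u v < 0"
    unfolding covers_below_def by blast
  have "u \<in> cls c p" "v \<in> cls c p" using uv cls_eq[OF d(1,2)] by auto
  then have up: "dt s q u p \<ge> 0" "dt s q v p \<ge> 0"
    using d(9) dt_rotate[of s q u p] dt_rotate[of s q v p] by (metis dt_rotate)+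
  have "om q p < 0" using d(4) dt_swap12[of s q p N] by simp
  then have "dt s q u v * om q p > 0" using uv by (simp add: mult_neg_neg)
  moreover have "dt s q u p * om q v \<le> 0" using uv up by (simp add: mult_nonneg_nonpos)
  moreover have "om q u * dt s q v p \<ge> 0" using uv up by simp
  ultimately show False using dt_pluecker[of s q u v p N] by simp
qed

text \<open>Left neighbours lie above the edge from \<open>q\<close> back to \<open>p\<close> by
  \<open>no_entry\<close>. Covering the meridian below \<open>q\<close> would thus enclose the
  direction of \<open>p\<close>, against \<open>local_between\<close>.\<close>

lemma edge_gap_other:
  assumes cusp: "cusp s N P cls c p q q' q"
  shows "\<not> covers_below s N cls (\<not> c) q"
proof
  note d = cuspD[OF cusp]
  assume "covers_below s N cls (\<not> c) q"
  then obtain u v where uv: "u \<in> cls (\<not> c) q" "v \<in> cls (\<not> c) q" "om q u > 0" "om q v < 0" "dt s q u v < 0"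
    unfolding covers_below_def by blast
  have pv: "dt s q p v < 0" using no_entry[OF cusp uv(2,4)] dt_swap12[of s q p v] by simp
  have pq: "om q p < 0" using d(4) dt_swap12[of s q p N] by simp
  have "dt s q p u * om q v = dt s q p v * om q u - om q p * dt s q u v"
    using dt_pluecker[of s q p u v N] by simp
  also have "\<dots> < 0" using mult_neg_pos[OF pv uv(3)] mult_neg_neg[OF pq uv(5)] by simp
  finally have pu: "dt s q p u > 0" using uv(4) by (simp add: mult_less_0_iff)
  show False
    using local_between[OF d(11), of v "\<not> c" u p] uv pv pu cls_sym[OF d(1,2)] d(14)
      dt_swap23[of s q v u] dt_swap23[of s q v p] by simp
qed

text \<open>Each of \<open>p\<close> and \<open>r\<close> would lie strictly above the edge from the
  other to \<open>q\<close>: by support if the colours agree, by \<open>no_entry\<close> otherwise.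
  The two orientations are opposite.\<close>

lemma edge_inj:
  assumes "cusp s N P cls c p q q' q" and "cusp s N P cls d r q r' q"
  shows "p = r"
proof (rule ccontr)
  assume "p \<noteq> r"
  have *: "dt s p q r > 0" if "p \<noteq> r" and cusp: "cusp s N P cls c p q q' q" "cusp s N P cls d r q r' q"
    for c d p r q' r'
  proof -
    note e = cuspD[OF cusp(1)] and f = cuspD[OF cusp(2)]
    have r: "r \<in> cls d q" "om q r < 0" using cls_sym[OF f(1,2)] f(4) dt_swap12[of s r q N] by auto
    show ?thesis
    proof (cases "c = d")
      case True
      then have "r \<in> cls c p" using r cls_eq[OF e(1,2)] by auto
      then show ?thesis using e(7)[of r] that(1) f(14) by auto
    next
      case False
      then show ?thesis using no_entry[OF cusp(1)] r by (cases c; cases d; simp)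
    qed
  qed
  have "dt s p q r > 0" "dt s r q p > 0" using *[OF _ assms] *[OF _ assms(2,1)] \<open>p \<noteq> r\<close> by auto
  then show False using dt_swap13[of s r q p] by simp
qed

lemma interior_below:
  assumes cusp: "cusp s N P cls c p q q' w" and "w \<noteq> q"
  shows "dt s p q w < 0"
proof (rule ccontr)
  note e = cuspD[OF cusp]
  assume "\<not> ?thesis"
  then have "dt s p q w = 0" using e by auto
  then have eq: "om w q *\<^sub>R p + om p w *\<^sub>R q = om p q *\<^sub>R w + 0"
    using dt_cramer[of s p q N w] dt_rotate[of s p q w] dt_swap12[of s w p N] by (simp add: algebra_simps)
  \<comment> \<open>Now \<open>w\<close> lies on the edge \<open>pq\<close>. Applying
    \<open>crossing\<close> to the polygon of the opposite colour at \<open>w\<close> makes its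
    conclusion absurd.\<close>
  have "c = (\<not> c) \<and> cls c p = cls (\<not> c) w"
    by (rule crossing[OF _ _ _ _ _ _ _ _ _ eq]) (use e assms in \<open>auto simp: cls_refl nonneg_combos_zero\<close>)
  then show False by simp
qed

text \<open>A left neighbour would either be an earlier contact in the wedge or be reached through
  one of the two edges; \<open>blocked_low\<close> and its reflection exclude the latter.\<close>

lemma interior_leftmost:
  assumes cusp: "cusp s N P cls c p q q' w" and w: "w \<noteq> q" "w \<noteq> q'"
    and z: "z \<in> cls d w"
  shows "om w z \<ge> 0"
proof (rule ccontr)
  interpret V: arrangement "- s" "- N" P cls by (rule flip_vertical)
  note e = cuspD[OF cusp]
  have cusp': "cusp (- s) (- N) P cls (\<not> c) p q' q w" using cusp cusp_flip by blast
  assume "\<not> ?thesis"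
  then have wz: "om w z < 0" by simp
  have low: "dt s p q w < 0" using interior_below[OF cusp w(1)] .
  have high: "dt s p q' w > 0" using V.interior_below[OF cusp' w(2)] by simp
  have zP: "z \<in> P" using z e(13) cls_in_P by blast
  have "p \<notin> cls d w"
  proof
    assume "p \<in> cls d w"
    then have "w \<in> cls d p" using cls_sym e(13) by blast
    then show False using e(9,10)[of w] low high by (cases "d = c") auto
  qed
  then have "z \<noteq> p" using z by blast
  moreover have "z \<noteq> - p" using wz e(17) dt_swap12[of s w p N] by auto
  ultimately have "om p z \<noteq> 0" using om_nonzero_P e(1) zP by blast
  moreover have "\<not> (om p z \<ge> 0 \<and> dt s p q' z < 0 \<or> om p z < 0 \<and> dt s p w z \<le> 0)"
    using blocked_low[OF cusp high z wz] by blast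
  moreover have "\<not> (om p z \<ge> 0 \<and> dt s p q z > 0 \<or> om p z < 0 \<and> dt s p w z \<ge> 0)"
    using V.blocked_low[OF cusp' _ z] low wz by auto
  ultimately show False using e(22)[OF zP wz] by linarith
qed

text \<open>The lower edge of the second cusp passes below \<open>w\<close>, hence it crosses the upper edge of the first one.\<close>

lemma interior_unique_aux:
  assumes c1: "cusp s N P cls c1 p1 q1 q1' w" and c2: "cusp s N P cls c2 p2 q2 q2' w"
    and w: "dt s p2 q2' w > 0" and p: "om p1 p2 > 0" "dt s p1 q1 p2 > 0"
  shows False
proof -
  note e = cuspD[OF c1] and f = cuspD[OF c2]
  have wq2: "w \<noteq> q2'" using w by auto
  \<comment> \<open>Up to scaling, \<open>m\<close> is the point of the lower edge of the second
    cusp on the meridian of \<open>w\<close>; its second form shows that it is below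
    \<open>w\<close>.\<close>
  define m where "m = om w q2' *\<^sub>R p2 + om p2 w *\<^sub>R q2'"
  have m: "m = om p2 q2' *\<^sub>R w - dt s p2 q2' w *\<^sub>R N"
    using dt_cramer[of s p2 q2' N w] dt_rotate[of s p2 q2' w] dt_swap12[of s w p2 N]
    unfolding m_def by (simp add: algebra_simps)
  have om: "om p1 m > 0" "om m p2 < 0" "om m q1 \<ge> 0"
    using e(4,17,20) f(5,17) dt_swap12[of s w p2 N] unfolding m
    by (auto simp: dt_diff dt_scaleR mult_pos_neg) (cases "w = q1"; simp)
  have below: "dt s p1 q1 m < 0"
  proof -
    have "om p2 q2' * dt s p1 q1 w \<le> 0" using e(19) f(5) by (simp add: mult_nonneg_nonpos)
    moreover have "dt s p2 q2' w * om p1 q1 > 0" using w e(4) by simp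
    ultimately show ?thesis unfolding m by (simp add: dt_diff dt_scaleR)
  qed
  obtain a b l k where *: "a > 0" "b \<ge> 0" "l > 0" "k > 0" "a *\<^sub>R p1 + b *\<^sub>R q1 = l *\<^sub>R p2 + k *\<^sub>R m"
    using cross_high[of s p1 q1 N m p2 thesis] e(4) om below p by auto
  have mK: "m \<in> nonneg_combos (cls (\<not> c2) p2)"
    unfolding m_def using f(1,3,17) f(21)[OF wq2] cls_refl by (intro combo2) auto
  have "c1 = (\<not> c2) \<and> cls c1 p1 = cls (\<not> c2) p2"
  proof (rule crossing[OF _ _ _ _ _ _ _ _ _ *(5)])
    show "k *\<^sub>R m \<in> nonneg_combos (cls (\<not> c2) p2)" using mK * nonneg_combos_scaleR by simp
  qed (use * e f p cls_refl in auto)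
  then have "p2 \<in> cls c1 p1" "q2' \<in> cls c1 p1" using f cls_refl by auto
  then have "dt s p1 q1 m \<ge> 0"
    unfolding m_def using e(9) f(17) f(21)[OF wq2] by (simp add: dt_add dt_scaleR)
  then show False using below by simp
qed

lemma interior_unique:
  assumes c1: "cusp s N P cls c1 p1 q1 q1' w" "w \<noteq> q1" "w \<noteq> q1'"
    and c2: "cusp s N P cls c2 p2 q2 q2' w" "w \<noteq> q2" "w \<noteq> q2'"
  shows "p1 = p2"
proof (rule ccontr)
  interpret V: arrangement "- s" "- N" P cls by (rule flip_vertical)
  assume ne: "p1 \<noteq> p2"
  have *: False if "om p1 p2 > 0" and c1: "cusp s N P cls c1 p1 q1 q1' w"
    and c2: "cusp s N P cls c2 p2 q2 q2' w" "w \<noteq> q2" "w \<noteq> q2'" for c1 p1 q1 q1' c2 p2 q2 q2'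
  proof -
    note e = cuspD[OF c1] and f = cuspD[OF c2(1)]
    have v: "cusp (- s) (- N) P cls (\<not> c1) p1 q1' q1 w" "cusp (- s) (- N) P cls (\<not> c2) p2 q2' q2 w"
      using c1 c2(1) cusp_flip by blast+
    have "dt s p2 q2 w < 0" "dt s p2 q2' w > 0"
      using interior_below[OF c2(1,2)] V.interior_below[OF v(2) c2(3)] by auto
    \<comment> \<open>The sweep reaches \<open>p2\<close> before \<open>w\<close>, so
      \<open>p2\<close> is outside the first wedge, below or above it. Reflection exchanges the two
      cases.\<close>
    moreover have "dt s p1 q1' p2 < 0 \<or> dt s p1 q1 p2 > 0"
      using e(22)[OF f(1)] that(1) f(17) dt_swap12[of s w p2 N] by simp
    ultimately show False
      using interior_unique_aux[OF c1 c2(1)] V.interior_unique_aux[OF v] that(1) by auto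
  qed
  note e = cuspD[OF c1(1)] and f = cuspD[OF c2(1)]
  have "p2 \<noteq> - p1" using e(17) f(17) by auto
  then have "om p1 p2 \<noteq> 0" using ne om_nonzero_P e(1) f(1) by blast
  then consider "om p1 p2 > 0" | "om p2 p1 > 0" using dt_swap12[of s p1 p2 N] by linarith
  then show False using *[OF _ c1(1) c2] *[OF _ c2(1) c1] by cases
qed

text \<open>
  If the target \<open>w\<close> of a cusp on its left is also the target of a cusp on its right, with both edges
  ending at \<open>w\<close> of the same colour, then the other polygon at \<open>w\<close> has no room for a second vertex.
\<close>

lemma facing_same_aux:
  assumes cusp: "cusp s N P cls c p w q' w" and facing: "cusp (- s) N P cls c r w r' w"
    and z: "z \<in> cls (\<not> c) w" "om w z < 0"
  shows False
proof -
  interpret H: arrangement "- s" N P cls by (rule flip_horizontal)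
  note e = cuspD[OF cusp] and f = H.cuspD[OF facing]
  have pw: "p \<in> cls c w" "r \<in> cls c w" using cls_sym e(1,2) f(1,2) by auto
  have om: "om w p < 0" "om w r > 0" using e(4) f(4) dt_swap12[of s w p N] dt_swap12[of s w r N] by auto
  have zp: "dt s w z p > 0" using no_entry[OF cusp z] dt_rotate[of s w z p] by simp
  have "p \<in> cls c r" using pw cls_eq e(13) by simp
  moreover have "p \<noteq> r" "p \<noteq> w" using om by auto
  ultimately have rp: "dt s w r p > 0" using f(7)[of p] dt_swap12[of s w r p] by simp
  have "dt s w r z * om w p = dt s w r p * om w z - om w r * dt s w z p"
    using dt_pluecker[of s w r z p N] by simp
  also have "\<dots> < 0" using mult_pos_neg[OF rp z(2)] mult_pos_pos[OF om(2) zp] by simp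
  finally have "dt s w r z > 0" using om by (simp add: mult_less_0_iff)
  then show False
    using local_between[OF e(13) pw(2,1) z(1)] z rp zp dt_same(1)[of s w N] by fastforce
qed

text \<open>
  If the two edges ending at \<open>w\<close> have different colours, then so do the edges below them. The upper one
  of these passes through the meridian of \<open>w\<close> at \<open>m\<close> and is trapped in the opposite wedge.
\<close>

lemma facing_other_aux:
  assumes cusp: "cusp s N P cls c p w q' w" and facing: "cusp (- s) N P cls (\<not> c) r w r' w"
    and le: "dt s r' r w * om p q' \<le> dt s p q' w * om r' r"
  shows False
proof -
  interpret H: arrangement "- s" N P cls by (rule flip_horizontal)
  note e = cuspD[OF cusp] and f = H.cuspD[OF facing]
  have r': "r' \<in> cls c r" using f(3) by simp
  have om: "om r' r > 0" "om w r > 0" "om r' w > 0" "om w q' > 0"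
    using f(5) f(4) f(21)[OF f(16)] e(21)[OF e(16)] dt_swap12[of s r' r N] dt_swap12[of s w r N]
      dt_swap12[of s r' w N] by auto
  have wr: "dt s r' r w > 0" using f(6) dt_swap12[of s r' r w] by simp
  have pr: "p \<noteq> r" using e(4) om(2) dt_swap12[of s p w N] by auto
  have rr: "r \<in> cls (\<not> c) w" "r' \<in> P" "r \<noteq> w" using cls_sym[OF f(1,2)] f(12,14) by auto
  have r_notin: "r \<notin> cls c w" using cls_meet[of w r c] rr e(13) by blast
  define m where "m = om w r *\<^sub>R r' + om r' w *\<^sub>R r"
  have m: "m = om r' r *\<^sub>R w - dt s r' r w *\<^sub>R N"
    using dt_cramer[of s r' r N w] dt_rotate[of s r' r w] dt_swap12[of s w r' N]
    unfolding m_def by (simp add: algebra_simps)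
  have omm: "om p m > 0" "om m q' > 0" "om m w = 0" "om m r' < 0"
    using e(4) om dt_swap12[of s w r' N] unfolding m by (auto simp: dt_diff dt_scaleR mult_pos_neg)
  \<comment> \<open>Thus \<open>le\<close> says that the edge from \<open>r'\<close> to
    \<open>r\<close> meets the meridian of \<open>w\<close> no lower than the edge from
    \<open>p\<close> to \<open>q'\<close> does.\<close>
  have above: "dt s p q' m \<ge> 0" using le unfolding m by (simp add: dt_diff dt_scaleR algebra_simps)
  have below: "dt s p w m < 0" using wr e(4) unfolding m by (simp add: dt_diff dt_scaleR)
  \<comment> \<open>Any crossing of the edge \<open>r'r\<close> with an edge of the wedge would put
    \<open>r\<close> into the polygon of colour \<open>c\<close> at \<open>p\<close>, which is also
    that of \<open>w\<close>; but \<open>r\<close> already shares the other polygon with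
    \<open>w\<close>.\<close>
  have low: False if "a > 0" "b \<ge> 0" "l \<ge> 0" "k > 0" "u \<in> cls d p" "d = (\<not> c) \<or> u = w"
    "a *\<^sub>R p + b *\<^sub>R u = l *\<^sub>R r' + k *\<^sub>R m" for a b l k u d
  proof -
    have "d = c \<and> cls d p = cls c r"
    proof (rule crossing)
      show "a *\<^sub>R p + b *\<^sub>R u = (k * om r' w) *\<^sub>R r + (l + k * om w r) *\<^sub>R r'"
        using that(7) unfolding m_def by (simp add: algebra_simps)
      show "(l + k * om w r) *\<^sub>R r' \<in> nonneg_combos (cls c r)"
        using that om r' f(1) by (intro nonneg_combos_scaleR cls_combos) auto
    qed (use that om f(1) e(1) pr cls_refl in auto)
    then have "r \<in> cls c p" using f(1) cls_refl by blast
    then show False using r_notin cls_eq[OF e(1,2)] by blast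
  qed
  show False
  proof (cases "dt s p q' m = 0")
    case True
    have "om m q' *\<^sub>R p + om p m *\<^sub>R q' = 0 *\<^sub>R r' + om p q' *\<^sub>R m"
      using dt_cramer[of s p q' N m] True dt_rotate[of s p q' m] dt_swap12[of s m p N]
      by (simp add: algebra_simps)
    then show ?thesis using low[of "om m q'" "om p m" 0 "om p q'" q' "\<not> c"] omm e by auto
  next
    case False
    then have above': "dt s p q' m > 0" using above by simp
    have "r' \<noteq> p"
    proof
      assume "r' = p"
      then have "cls c p = cls c r" using cls_eq f(1) r' by blast
      then show False using r_notin cls_eq[OF e(1,2)] cls_refl[OF f(1)] by auto
    qed
    moreover have "r' \<noteq> - p" using om(3) e(17) by auto
    ultimately have "om p r' \<noteq> 0" using om_nonzero_P e(1) rr by blast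
    moreover have "om p r' > 0 \<Longrightarrow> dt s p q' r' < 0 \<or> dt s p w r' > 0"
      using e(22)[OF rr(2)] om(3) dt_swap12[of s w r' N] by simp
    moreover have "dt s p q' r' < 0" if "om p r' < 0" "dt s p m r' \<le> 0"
      using left_low[OF omm(1) e(5) above' that] .
    moreover have "dt s p w r' > 0" if "om p r' < 0" "dt s p m r' \<ge> 0"
      using left_high[OF omm(1) e(4) below that] .
    ultimately consider
        "dt s p q' r' < 0" "om p r' \<ge> 0 \<or> dt s p m r' \<le> 0"
      | "dt s p w r' > 0" "om p r' \<ge> 0 \<or> dt s p m r' \<ge> 0" by linarith
    then show ?thesis
    proof cases
      case 1
      obtain a b l k where "a > 0" "b \<ge> 0" "l \<ge> 0" "k > 0" "a *\<^sub>R p + b *\<^sub>R q' = l *\<^sub>R r' + k *\<^sub>R m"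
        using cross_low[of s p q' N m r' thesis] e(5) omm above 1 by auto
      then show ?thesis using low e(3) by blast
    next
      case 2
      obtain a b l k where "a > 0" "b \<ge> 0" "l > 0" "k > 0" "a *\<^sub>R p + b *\<^sub>R w = l *\<^sub>R r' + k *\<^sub>R m"
        using cross_high[of s p w N m r' thesis] e(4) omm below 2 by auto
      then show ?thesis using low e(2) less_imp_le by blast
    qed
  qed
qed

text \<open>For equal colours, a second vertex of the other polygon is left or right of
  \<open>w\<close>; for different colours, one of the two lower edges is the higher one at the
  meridian of \<open>w\<close>. Horizontal reflection exchanges the alternatives.\<close>

lemma no_facing:
  assumes cusp: "cusp s N P cls c p w q' w" and facing: "cusp (- s) N P cls d r w r' w"
  shows False
proof -
  interpret H: arrangement "- s" N P cls by (rule flip_horizontal)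
  note e = cuspD[OF cusp] and f = H.cuspD[OF facing]
  have cusp': "cusp (- (- s)) N P cls c p w q' w" using cusp by simp
  show False
  proof (cases "d = c")
    case True
    obtain z where z: "z \<in> cls (\<not> c) w" "z \<noteq> w" using cls_nontrivial e(13) by blast
    then have "om w z \<noteq> 0" using om_nonzero e(13) by blast
    then show False
      using facing_same_aux[OF cusp facing[unfolded True] z(1)]
        H.facing_same_aux[OF facing[unfolded True] cusp' z(1)] by (auto simp: linorder_neq_iff)
  next
    case False
    then have d: "d = (\<not> c)" by auto
    have "(- dt s q' p w) * (- om r r') = dt s p q' w * om r' r"
      "(- dt s r r' w) * (- om q' p) = dt s r' r w * om p q'"
      using dt_swap12[of s q' p] dt_swap12[of s r r'] by simp_all
    then show False
      using facing_other_aux[OF cusp facing[unfolded d]]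
        H.facing_other_aux[OF facing[unfolded d], of p q'] cusp' by force
  qed
qed

section \<open>Counting cusps\<close>

text \<open>Slopes at \<open>p\<close> are measured against a reference vertex \<open>e\<close>;
  \<open>dt_pluecker\<close> turns a comparison of the quotients into an orientation.\<close>

lemma lowest_right:
  assumes p: "p \<in> P" and "right_nbr s N cls c p"
  obtains q where "q \<in> cls c p" "om p q > 0"
    "\<And>z. \<lbrakk>z \<in> cls c p; om p z > 0\<rbrakk> \<Longrightarrow> dt s p q z \<ge> 0"
proof -
  define A where "A = {z \<in> cls c p. om p z > 0}"
  obtain e where e: "e \<in> A" using assms unfolding right_nbr_def A_def by auto
  have "finite A" using finite_cls[OF p] unfolding A_def by simp
  then obtain q where q: "q \<in> A" "\<And>z. z \<in> A \<Longrightarrow> dt s p e q / om p q \<le> dt s p e z / om p z"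
    using ex_arg_min[of A "\<lambda>z. dt s p e z / om p z"] e by auto
  have "dt s p q z \<ge> 0" if "z \<in> A" for z
  proof -
    have pos: "om p e > 0" "om p q > 0" "om p z > 0" using e q(1) that unfolding A_def by auto
    then have "dt s p e q * om p z \<le> dt s p e z * om p q"
      using q(2)[OF that] by (simp add: field_simps)
    then have "dt s p q z * om p e \<ge> 0"
      using dt_pluecker[of s p q z e N] dt_swap23[of s p q e] dt_swap23[of s p z e]
      by (simp add: algebra_simps)
    then show ?thesis using pos by (simp add: zero_le_mult_iff)
  qed
  then show thesis using that[of q] q(1) unfolding A_def by blast
qed

lemma om_pluecker: "om a b * om c d = om a c * om b d - om a d * om b c"
  unfolding dt_rotate[of s _ _ N] by (rule dt_pluecker)

text \<open>The same device orders the meridians to the right of \<open>p\<close>; genericity makes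
  the order strict.\<close>

lemma leftmost:
  assumes "finite A" "A \<noteq> {}" and A: "\<And>z. z \<in> A \<Longrightarrow> z \<in> P \<and> om p z > 0"
  obtains w where "w \<in> A" "\<And>z. \<lbrakk>z \<in> A; z \<noteq> w\<rbrakk> \<Longrightarrow> om w z > 0"
proof -
  obtain e where e: "e \<in> A" using assms by auto
  obtain w where w: "w \<in> A" "\<And>z. z \<in> A \<Longrightarrow> - om w e / om p w \<le> - om z e / om p z"
    using ex_arg_min[OF assms(1,2), of "\<lambda>w. - om w e / om p w"] by auto
  have "om w z > 0" if z: "z \<in> A" "z \<noteq> w" for z
  proof -
    have pos: "om p e > 0" "om p w > 0" "om p z > 0" using A e w(1) z by auto
    then have "om z e * om p w \<le> om w e * om p z"
      using w(2)[OF z(1)] by (simp add: field_simps)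
    moreover have "om w z * om p e = om p z * om w e - om p w * om z e"
      using om_pluecker[of w z p e] dt_swap12[of s w p N] dt_swap12[of s z p N]
      by (simp add: algebra_simps)
    ultimately have "om w z * om p e \<ge> 0" by (simp add: algebra_simps)
    then have "om w z \<ge> 0" using pos by (simp add: zero_le_mult_iff)
    moreover have "z \<noteq> - w" using pos by auto
    then have "om w z \<noteq> 0" using om_nonzero_P A w(1) z by blast
    ultimately show ?thesis by simp
  qed
  then show thesis using that w(1) by blast
qed

lemma right_colours_nonzero:
  assumes p: "p \<in> P" and u: "u \<in> cls c p" "om p u > 0" and v: "v \<in> cls (\<not> c) p" "om p v > 0"
  shows "dt s p u v \<noteq> 0"
proof
  assume 0: "dt s p u v = 0"
  show False
  proof (rule local_disjoint[OF p v(1)])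
    show "om p u *\<^sub>R v + 0 = om p v *\<^sub>R u + om v u *\<^sub>R p"
      using dt_cramer[of s p u N v] 0 dt_rotate[of s p u v] dt_swap12[of s v p N]
      by (simp add: algebra_simps)
  qed (use p u v in \<open>auto intro: nonneg_combos_zero nonneg_combos_scaleR cls_combos\<close>)
qed

text \<open>An offending \<open>z\<close> would be left of \<open>p\<close>, and the angle from
  \<open>z\<close> to \<open>q\<close> would contain the direction of \<open>q'\<close>.\<close>

lemma boundary_edge:
  assumes p: "p \<in> P" and q: "q \<in> cls c p" "om p q > 0"
    and low: "\<And>z. \<lbrakk>z \<in> cls c p; om p z > 0\<rbrakk> \<Longrightarrow> dt s p q z \<ge> 0"
    and q': "q' \<in> cls (\<not> c) p" "om p q' > 0" "dt s p q' q > 0"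
    and z: "z \<in> cls c p" "z \<noteq> p" "z \<noteq> q"
  shows "dt s p q z > 0"
proof (rule ccontr)
  assume "\<not> ?thesis"
  moreover have "dt s p q z \<noteq> 0" using dt_cls_nonzero[OF p q(1) z(1) _ z(2)] z q(2) dt_same(1)[of s p N] by force
  ultimately have neg: "dt s p q z < 0" by simp
  then have "om p z < 0" using low[OF z(1)] om_nonzero[OF p z(1,2)] by linarith
  moreover have zq: "dt s p z q > 0" using neg dt_swap23[of s p z q] by simp
  ultimately have "dt s p z q * om p q' - om p z * dt s p q' q > 0"
    using q' by (smt (verit) mult_neg_pos mult_pos_pos)
  then have "dt s p z q' * om p q > 0"
    using dt_pluecker[of s p z q' q N] by simp
  then have "dt s p z q' > 0" using q(2) by (simp add: zero_less_mult_iff)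
  then show False
    using local_between[OF p z(1) q(1) q'(1)] q' zq dt_same(1)[of s p N] by force
qed

text \<open>The gap lies between the lowest right edge of one polygon and the highest right edge of
  the other. Comparing the two lowest right edges tells which colour is above;
  \<open>local_between\<close> prevents interleaving.\<close>

lemma cusp_exists:
  assumes p: "p \<in> P" and right: "\<And>c. right_nbr s N cls c p"
  shows "\<exists>c q q' w. cusp s N P cls c p q q' w"
proof -
  interpret V: arrangement "- s" "- N" P cls by (rule flip_vertical)
  have *: "\<exists>q q' w. cusp s N P cls c p q q' w"
    if r: "r \<in> cls (\<not> c) p" "om p r > 0" and q: "q \<in> cls c p" "om p q > 0"
      and low: "\<And>z. \<lbrakk>z \<in> cls c p; om p z > 0\<rbrakk> \<Longrightarrow> dt s p q z \<ge> 0" and rq: "dt s p r q \<ge> 0" for c r q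
  proof -
    have rq: "dt s p r q > 0"
      using rq right_colours_nonzero[OF p q r] dt_swap23[of s p r q] by simp
    obtain q' where q': "q' \<in> cls (\<not> c) p" "om p q' > 0"
      and high: "\<And>z. \<lbrakk>z \<in> cls (\<not> c) p; om p z > 0\<rbrakk> \<Longrightarrow> dt s p q' z \<le> 0"
      using V.lowest_right[OF p, of "\<not> c"] right[of "\<not> c"] unfolding right_nbr_def by auto
    have q'q: "dt s p q' q > 0"
    proof (rule ccontr)
      assume "\<not> ?thesis"
      then have qq': "dt s p q q' > 0"
        using right_colours_nonzero[OF p q q'] dt_swap23[of s p q' q] by simp
      have "dt s p r q * om p q' + om p r * dt s p q q' > 0"
        using rq qq' r q' by (intro add_pos_pos mult_pos_pos)
      then have "dt s p r q' * om p q > 0"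
        using dt_pluecker[of s p r q' q N] dt_swap23[of s p q' q] by simp
      then have "dt s p r q' > 0" using q by (simp add: zero_less_mult_iff)
      then show False
        using local_between[OF p r(1) q'(1), of q] q rq qq' dt_same(1)[of s p N] by force
    qed
    have qq': "dt s p q q' < 0" using q'q dt_swap23[of s p q q'] by simp
    have low': "dt s p q z > 0" if "z \<in> cls c p" "z \<noteq> p" "z \<noteq> q" for z
      using boundary_edge[OF p q low q' q'q that] .
    have high': "dt s p q' z < 0" if "z \<in> cls (\<not> c) p" "z \<noteq> p" "z \<noteq> q'" for z
      using V.boundary_edge[OF p q'(1), of q z] q' high q qq' that by simp
    have "q \<in> wedge s N P p q q'"
      using q q'q cls_in_P[OF p] unfolding wedge_def by auto
    then have "wedge s N P p q q' \<noteq> {}" "finite (wedge s N P p q q')"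
      using finite_P unfolding wedge_def by auto
    moreover have "z \<in> P \<and> om p z > 0" if "z \<in> wedge s N P p q q'" for z
      using that unfolding wedge_def by blast
    ultimately obtain w where "w \<in> wedge s N P p q q'"
      "\<And>z. \<lbrakk>z \<in> wedge s N P p q q'; z \<noteq> w\<rbrakk> \<Longrightarrow> om w z > 0"
      using leftmost by metis
    then have "cusp s N P cls c p q q' w"
      using p q q' q'q low' high' unfolding cusp_def by blast
    then show ?thesis by blast
  qed
  obtain q1 where q1: "q1 \<in> cls True p" "om p q1 > 0"
    "\<And>z. \<lbrakk>z \<in> cls True p; om p z > 0\<rbrakk> \<Longrightarrow> dt s p q1 z \<ge> 0"
    using lowest_right[OF p right[of True]] by blast
  obtain q0 where q0: "q0 \<in> cls False p" "om p q0 > 0"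
    "\<And>z. \<lbrakk>z \<in> cls False p; om p z > 0\<rbrakk> \<Longrightarrow> dt s p q0 z \<ge> 0"
    using lowest_right[OF p right[of False]] by blast
  show ?thesis
  proof (cases "dt s p q0 q1 \<ge> 0")
    case True
    then show ?thesis using *[of q0 True q1] q0 q1 by auto
  next
    case False
    then have "dt s p q1 q0 \<ge> 0" using dt_swap23[of s p q1 q0] by simp
    then show ?thesis using *[of q1 False q0] q0 q1 by auto
  qed
qed

lemma covers_below_horizontal: "covers_below (- s) N cls c p = covers_below s N cls c p"
proof -
  have "covers_below (- t) N cls c p" if t: "covers_below t N cls c p" for t
  proof -
    obtain u v where "u \<in> cls c p" "v \<in> cls c p" "dt t p u N > 0" "dt t p v N < 0" "dt t p u v < 0"
      using t unfolding covers_below_def by blast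
    then show ?thesis
      unfolding covers_below_def
      by (intro bexI[of _ v] bexI[of _ u]) (auto simp: dt_swap23[of t p v u])
  qed
  from this[of s] this[of "- s"] show ?thesis by auto
qed

text \<open>Only targets ending the upper edge are recorded; the lower edge is covered by negating
  both parameters. Sign and pole are parameters so that the reflected interpretations share these
  sets.\<close>

definition edge_hits :: "real \<Rightarrow> real^3 \<Rightarrow> (real^3) set" where
  "edge_hits t M = {p. \<exists>c q q'. cusp t M P cls c p q q' q}"

definition edge_targets :: "real \<Rightarrow> real^3 \<Rightarrow> (real^3) set" where
  "edge_targets t M = {w. \<exists>c p q'. cusp t M P cls c p w q' w}"

definition interior_hits :: "real \<Rightarrow> real^3 \<Rightarrow> (real^3) set" where
  "interior_hits t M = {p. \<exists>c q q' w. cusp t M P cls c p q q' w \<and> w \<noteq> q \<and> w \<noteq> q'}"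

definition right_cusps :: "real \<Rightarrow> real^3 \<Rightarrow> (real^3) set" where
  "right_cusps t M = {p \<in> P. \<forall>c. right_nbr t M cls c p}"

definition left_extremes :: "real \<Rightarrow> real^3 \<Rightarrow> (real^3) set" where
  "left_extremes t M = {p \<in> P. \<forall>c. \<not> right_nbr (- t) M cls c p}"

definition open_below :: "real \<Rightarrow> real^3 \<Rightarrow> (real^3) set" where
  "open_below t M = {p \<in> P. \<forall>c. \<not> covers_below t M cls c p}"

lemma card_edge_hits:
  "card (edge_hits s N) \<le> card (edge_targets s N)" "edge_targets s N \<subseteq> open_below s N"
  "edge_hits s N \<subseteq> P"
proof -
  show "edge_targets s N \<subseteq> open_below s N"
  proof
    fix w assume "w \<in> edge_targets s N"
    then obtain c p q' where c: "cusp s N P cls c p w q' w" unfolding edge_targets_def by blast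
    then have "\<not> covers_below s N cls d w" for d
    proof (cases "d = c")
      case True
      then show ?thesis using edge_gap_same[OF c] by simp
    next
      case False
      then have "d = (\<not> c)" by auto
      then show ?thesis using edge_gap_other[OF c] by simp
    qed
    then show "w \<in> open_below s N" using cuspD(13)[OF c] unfolding open_below_def by blast
  qed
  then have fin: "finite (edge_targets s N)"
    by (rule finite_subset) (use finite_P in \<open>simp add: open_below_def\<close>)
  define g where "g w = (SOME p. \<exists>c q'. cusp s N P cls c p w q' w)" for w
  have "edge_hits s N \<subseteq> g ` edge_targets s N"
  proof
    fix p assume "p \<in> edge_hits s N"
    then obtain c w q' where c: "cusp s N P cls c p w q' w" unfolding edge_hits_def by blast
    then have "\<exists>p. \<exists>d q'. cusp s N P cls d p w q' w" by blast
    then have "\<exists>d q'. cusp s N P cls d (g w) w q' w" unfolding g_def by (rule someI_ex)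
    then have "g w = p" using edge_inj c by blast
    then show "p \<in> g ` edge_targets s N" using c unfolding edge_targets_def by blast
  qed
  then show "card (edge_hits s N) \<le> card (edge_targets s N)" using surj_card_le[OF fin] by blast
  show "edge_hits s N \<subseteq> P" unfolding edge_hits_def cusp_def by blast
qed

lemma card_interior_hits:
  "card (interior_hits s N) \<le> card (left_extremes s N)" "interior_hits s N \<subseteq> P"
proof -
  have fin: "finite (left_extremes s N)" using finite_P unfolding left_extremes_def by simp
  define g where "g w = (SOME p. \<exists>c q q'. cusp s N P cls c p q q' w \<and> w \<noteq> q \<and> w \<noteq> q')" for w
  have "interior_hits s N \<subseteq> g ` left_extremes s N"
  proof
    fix p assume "p \<in> interior_hits s N"
    then obtain c w q q' where c: "cusp s N P cls c p q q' w" "w \<noteq> q" "w \<noteq> q'"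
      unfolding interior_hits_def by blast
    then have "\<exists>p. \<exists>d q q'. cusp s N P cls d p q q' w \<and> w \<noteq> q \<and> w \<noteq> q'" by blast
    then have "\<exists>d q q'. cusp s N P cls d (g w) q q' w \<and> w \<noteq> q \<and> w \<noteq> q'"
      unfolding g_def by (rule someI_ex)
    then have "g w = p" using interior_unique c by blast
    moreover have "w \<in> left_extremes s N"
      using interior_leftmost[OF c] cuspD(13)[OF c(1)]
      unfolding left_extremes_def right_nbr_def by (auto simp: not_less)
    ultimately show "p \<in> g ` left_extremes s N" by blast
  qed
  then show "card (interior_hits s N) \<le> card (left_extremes s N)" using surj_card_le[OF fin] by blast
  show "interior_hits s N \<subseteq> P" unfolding interior_hits_def cusp_def by blast
qed

lemma right_cusps_cover:
  "right_cusps s N \<subseteq> edge_hits s N \<union> edge_hits (- s) (- N) \<union> interior_hits s N"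
proof
  fix p assume "p \<in> right_cusps s N"
  then have "\<exists>c q q' w. cusp s N P cls c p q q' w"
    unfolding right_cusps_def by (intro cusp_exists) auto
  then obtain c q q' w where c: "cusp s N P cls c p q q' w" by blast
  then have c': "cusp (- s) (- N) P cls (\<not> c) p q' q w" using cusp_flip by blast
  show "p \<in> edge_hits s N \<union> edge_hits (- s) (- N) \<union> interior_hits s N"
  proof (cases "w = q \<or> w = q'")
    case True
    then show ?thesis using c c' unfolding edge_hits_def by auto
  next
    case False
    then show ?thesis using c unfolding interior_hits_def by auto
  qed
qed

lemma card_right_cusps:
  "card (right_cusps s N) \<le> card (edge_targets s N) + card (edge_targets (- s) (- N))
     + card (left_extremes s N)"
proof -
  interpret V: arrangement "- s" "- N" P cls by (rule flip_vertical)
  have fin: "finite (edge_hits s N)" "finite (edge_hits (- s) (- N))" "finite (interior_hits s N)"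
    using finite_subset[OF card_edge_hits(3) finite_P] finite_subset[OF V.card_edge_hits(3) finite_P]
      finite_subset[OF card_interior_hits(2) finite_P] by simp_all
  then have "card (right_cusps s N) \<le> card (edge_hits s N \<union> edge_hits (- s) (- N) \<union> interior_hits s N)"
    using right_cusps_cover by (intro card_mono) auto
  also have "\<dots> \<le> card (edge_hits s N) + card (edge_hits (- s) (- N)) + card (interior_hits s N)"
    using card_Un_le[of "edge_hits s N" "edge_hits (- s) (- N)"]
      card_Un_le[of "edge_hits s N \<union> edge_hits (- s) (- N)" "interior_hits s N"] by simp
  finally show ?thesis
    using card_edge_hits(1) V.card_edge_hits(1) card_interior_hits(1) by linarith
qed

lemma card_edge_targets:
  "card (edge_targets s N) + card (edge_targets (- s) N) \<le> card (open_below s N)"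
proof -
  interpret H: arrangement "- s" N P cls by (rule flip_horizontal)
  have sub: "edge_targets s N \<subseteq> open_below s N" "edge_targets (- s) N \<subseteq> open_below s N"
    using card_edge_hits(2) H.card_edge_hits(2) unfolding open_below_def covers_below_horizontal .
  have fin: "finite (open_below s N)" using finite_P unfolding open_below_def by simp
  have "w \<notin> edge_targets (- s) N" if w: "w \<in> edge_targets s N" for w
  proof
    assume "w \<in> edge_targets (- s) N"
    then obtain d r r' where "cusp (- s) N P cls d r w r' w" unfolding edge_targets_def by auto
    moreover obtain c p p' where "cusp s N P cls c p w p' w" using w unfolding edge_targets_def by auto
    ultimately show False using no_facing by blast
  qed
  then have "edge_targets s N \<inter> edge_targets (- s) N = {}" by blast
  then have "card (edge_targets s N) + card (edge_targets (- s) N) = card (edge_targets s N \<union> edge_targets (- s) N)"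
    using card_Un_disjoint[OF finite_subset[OF sub(1) fin] finite_subset[OF sub(2) fin]] by simp
  also have "\<dots> \<le> card (open_below s N)" using sub fin by (intro card_mono) auto
  finally show ?thesis .
qed

lemma card_eq_sum_of_bool: "card {p \<in> P. Q p} = (\<Sum>p\<in>P. of_bool (Q p))"
  unfolding card_eq_sum of_bool_def by (rule sum.inter_filter[OF finite_P])

theorem card_le_extremes:
  "card P \<le> (\<Sum>c\<in>UNIV. card {p \<in> P. \<not> right_nbr s N cls c p} + card {p \<in> P. \<not> right_nbr (- s) N cls c p})"
proof -
  interpret V: arrangement "- s" "- N" P cls by (rule flip_vertical)
  interpret H: arrangement "- s" N P cls by (rule flip_horizontal)
  \<comment> \<open>The bound on right-opening gaps is added to its mirror image; edge targets from
    the two sides are disjoint, hence bounded by the contacts open below and those open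
    above.\<close>
  have "card (right_cusps s N) + card (right_cusps (- s) N)
      \<le> card (open_below s N) + card (open_below (- s) (- N))
        + card (left_extremes s N) + card (left_extremes (- s) N)"
    using card_right_cusps H.card_right_cusps card_edge_targets V.card_edge_targets
    unfolding minus_minus by linarith
  then have 1: "(\<Sum>p\<in>P. of_bool (\<forall>c. right_nbr s N cls c p) + of_bool (\<forall>c. right_nbr (- s) N cls c p) :: nat)
    \<le> (\<Sum>p\<in>P. of_bool (\<forall>c. \<not> covers_below s N cls c p) + of_bool (\<forall>c. \<not> covers_below (- s) (- N) cls c p)
      + of_bool (\<forall>c. \<not> right_nbr (- s) N cls c p) + of_bool (\<forall>c. \<not> right_nbr s N cls c p))"
    unfolding right_cusps_def open_below_def left_extremes_def card_eq_sum_of_bool sum.distrib minus_minus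
    by linarith
  define ext :: "real^3 \<Rightarrow> nat" where
    "ext p = (\<Sum>c\<in>UNIV. of_bool (\<not> right_nbr s N cls c p) + of_bool (\<not> right_nbr (- s) N cls c p))" for p
  \<comment> \<open>A polygon that is not extreme at \<open>p\<close> covers one vertical side, and
    two polygons never cover the same one. So each open side is paid for by an extreme
    incidence.\<close>
  have open_ext: "of_bool (\<forall>c. \<not> covers_below s N cls c p)
    + of_bool (\<forall>c. \<not> covers_below (- s) (- N) cls c p) \<le> ext p" if "p \<in> P" for p
  proof -
    have "right_nbr s N cls c p \<and> right_nbr (- s) N cls c p
      \<longrightarrow> covers_below s N cls c p \<or> covers_below (- s) (- N) cls c p" for c
      using covers_below_or_above[OF that] by blast
    from this[of True] this[of False] show ?thesis
      using not_covers_below_both_colours[OF that, of True]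
        V.not_covers_below_both_colours[OF that, of True]
      unfolding ext_def UNIV_bool all_bool_eq by (auto simp: of_bool_def)
  qed
  \<comment> \<open>On each side, the indicators of "both" and of the two failures add up to 1 plus
    the indicator of "neither".\<close>
  have incl_excl: "of_bool (\<forall>c. right_nbr s N cls c p) + of_bool (\<forall>c. right_nbr (- s) N cls c p) + ext p
    = 2 + of_bool (\<forall>c. \<not> right_nbr (- s) N cls c p) + of_bool (\<forall>c. \<not> right_nbr s N cls c p)" for p
    unfolding ext_def UNIV_bool all_bool_eq
    by (cases "right_nbr s N cls True p"; cases "right_nbr s N cls False p";
        cases "right_nbr (- s) N cls True p"; cases "right_nbr (- s) N cls False p"; simp)
  have "(\<Sum>p\<in>P. of_bool (\<forall>c. right_nbr s N cls c p) + of_bool (\<forall>c. right_nbr (- s) N cls c p) + ext p)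
    = (\<Sum>p\<in>P. 2 + of_bool (\<forall>c. \<not> right_nbr (- s) N cls c p) + of_bool (\<forall>c. \<not> right_nbr s N cls c p))"
    by (rule sum.cong[OF refl incl_excl])
  moreover have "(\<Sum>p\<in>P. of_bool (\<forall>c. \<not> covers_below s N cls c p)
    + of_bool (\<forall>c. \<not> covers_below (- s) (- N) cls c p)) \<le> (\<Sum>p\<in>P. ext p)"
    by (rule sum_mono[OF open_ext])
  ultimately have "2 * card P \<le> 2 * (\<Sum>p\<in>P. ext p)"
    using 1 unfolding sum.distrib sum_constant of_nat_id by linarith
  moreover have "(\<Sum>p\<in>P. ext p)
    = (\<Sum>c\<in>UNIV. card {p \<in> P. \<not> right_nbr s N cls c p} + card {p \<in> P. \<not> right_nbr (- s) N cls c p})"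
    unfolding ext_def card_eq_sum_of_bool sum.distrib
    by (subst (1 2) sum.swap) (rule refl)
  ultimately show ?thesis by linarith
qed

lemma right_extreme_unique:
  assumes p: "p \<in> P" "q \<in> cls c p" and "\<not> right_nbr s N cls c p" "\<not> right_nbr s N cls c q"
  shows "p = q"
proof (rule ccontr)
  assume "p \<noteq> q"
  moreover have "om p q \<le> 0" "om q p \<le> 0"
    using assms cls_sym[OF p] unfolding right_nbr_def by (auto simp: not_less)
  ultimately show False using om_nonzero[OF p] dt_swap12[of s q p N] by auto
qed

text \<open>A polygon around a pole has no rightmost vertex: the values \<open>om p z\<close>,
  weighted by \<open>f\<close>, add up to 0 and are not all 0. A negative \<open>k\<close> serves
  the pole \<open>- N\<close>.\<close>

lemma right_nbr_surrounded:
  assumes p: "p \<in> P" and f: "\<And>z. f z > 0" and N: "k *\<^sub>R N = (\<Sum>z\<in>cls c p. f z *\<^sub>R z)"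
  shows "right_nbr s N cls c p"
proof (rule ccontr)
  assume "\<not> ?thesis"
  then have nonpos: "om p z \<le> 0" if "z \<in> cls c p" for z
    using that unfolding right_nbr_def by (auto simp: not_less)
  obtain z where z: "z \<in> cls c p" "z \<noteq> p" using cls_nontrivial p by blast
  then have "f z * om p z < 0"
    using nonpos[of z] om_nonzero[OF p, of z c] f[of z] by (auto simp: mult_less_0_iff)
  moreover have "f y * om p y \<le> 0" if "y \<in> cls c p" for y
    using nonpos[OF that] f[of y] by (auto simp: mult_le_0_iff)
  ultimately have "(\<Sum>y\<in>cls c p. f y * om p y) < (\<Sum>y\<in>cls c p. 0)"
    using z by (intro sum_strict_mono_ex1 finite_cls p) auto
  moreover have "(\<Sum>y\<in>cls c p. f y * om p y) = - dt s p N (k *\<^sub>R N)"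
    unfolding N dt_sum sum_negf[symmetric] by (simp add: dt_swap23[of s p N])
  ultimately show False by (simp add: dt_scaleR)
qed

end

section \<open>The cones of a set of diameter one\<close>

text \<open>\<open>w\<close> is the total weight of one representation of \<open>v\<close>, so it
  serves all functionals \<open>d\<close> at once.\<close>

lemma nonneg_combos_weight:
  assumes "v \<in> nonneg_combos A"
  obtains w where "w \<ge> 0" "\<And>d k. (\<And>a. a \<in> A \<Longrightarrow> a \<bullet> d \<ge> k) \<Longrightarrow> v \<bullet> d \<ge> w * k"
    "\<And>d k. (\<And>a. a \<in> A \<Longrightarrow> a \<bullet> d \<le> k) \<Longrightarrow> v \<bullet> d \<le> w * k"
proof -
  obtain f where f: "\<And>z. 0 \<le> f z" "v = (\<Sum>z\<in>A. f z *\<^sub>R z)"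
    using nonneg_combosE[OF assms] by metis
  have v: "v \<bullet> d = (\<Sum>z\<in>A. f z * (z \<bullet> d))" for d
    unfolding f(2) by (simp add: inner_sum_left)
  show thesis
  proof
    show "sum f A \<ge> 0" using f(1) by (simp add: sum_nonneg)
    show "v \<bullet> d \<ge> sum f A * k" if "\<And>a. a \<in> A \<Longrightarrow> a \<bullet> d \<ge> k" for d k
      unfolding v sum_distrib_right using that f(1) by (intro sum_mono mult_left_mono)
    show "v \<bullet> d \<le> sum f A * k" if "\<And>a. a \<in> A \<Longrightarrow> a \<bullet> d \<le> k" for d k
      unfolding v sum_distrib_right using that f(1) by (intro sum_mono mult_left_mono)
  qed
qed

lemma nonneg_combos_uminus:
  assumes "v \<in> nonneg_combos A"
  shows "- v \<in> nonneg_combos (uminus ` A)"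
proof -
  obtain f where f: "\<And>z. 0 \<le> f z" "v = (\<Sum>z\<in>A. f z *\<^sub>R z)"
    using nonneg_combosE[OF assms] by metis
  have "- v = (\<Sum>z\<in>uminus ` A. f (- z) *\<^sub>R z)"
    unfolding f(2) by (subst sum.reindex) (auto simp: sum_negf)
  then show ?thesis unfolding nonneg_combos_def using f(1) by (auto intro!: exI[of _ "\<lambda>z. f (- z)"])
qed

text \<open>The weights are powers of \<open>t\<close> with distinct exponents. Each determinant
  becomes a nonzero polynomial in \<open>t\<close>, and some positive \<open>t\<close> avoids the
  finitely many roots.\<close>

lemma generic_positive_combo:
  fixes A :: "(real^3) set"
  assumes "finite A" "finite Q" and Q: "\<And>p q. (p, q) \<in> Q \<Longrightarrow> \<exists>z\<in>A. det3 p q z \<noteq> 0"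
  shows "\<exists>f. (\<forall>z. f z > 0) \<and> (\<forall>(p, q)\<in>Q. det3 p q (\<Sum>z\<in>A. f z *\<^sub>R z) \<noteq> 0)"
proof -
  obtain i :: "real^3 \<Rightarrow> nat" where i: "inj_on i A"
    using finite_imp_inj_to_nat_seg[OF assms(1)] by blast
  define F where "F = (\<lambda>(p, q). \<Sum>z\<in>A. monom (det3 p q z) (i z))"
  have "F (p, q) \<noteq> 0" if pq: "(p, q) \<in> Q" for p q
  proof -
    obtain z where z: "z \<in> A" "det3 p q z \<noteq> 0" using Q[OF pq] by blast
    have "coeff (F (p, q)) (i z) = (\<Sum>y\<in>A. if y = z then det3 p q y else 0)"
      unfolding F_def prod.case coeff_sum coeff_monom
      using i z by (intro sum.cong) (auto simp: inj_on_def)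
    also have "\<dots> = det3 p q z" using z assms(1) by simp
    finally show ?thesis using z(2) by auto
  qed
  then have "finite (\<Union>pq\<in>Q. {t. poly (F pq) t = 0})"
    using assms(2) by (auto intro: poly_roots_finite)
  moreover have "infinite {0::real<..}" by (rule infinite_Ioi)
  ultimately obtain t :: real where t: "t > 0" "t \<notin> (\<Union>pq\<in>Q. {t. poly (F pq) t = 0})"
    by (metis finite_subset greaterThan_iff subsetI)
  have det3_sum: "det3 p q (\<Sum>z\<in>A. f z *\<^sub>R z) = (\<Sum>z\<in>A. f z * det3 p q z)" for p q f
    using dt_sum(2)[of 1 p q f A] by (simp add: dt_def)
  have "det3 p q (\<Sum>z\<in>A. t ^ i z *\<^sub>R z) \<noteq> 0" if "(p, q) \<in> Q" for p q
    using t(2) that unfolding det3_sum F_def by (force simp: poly_sum poly_monom mult.commute)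
  then show ?thesis using t(1) by (intro exI[of _ "\<lambda>z. t ^ i z"]) auto
qed

text \<open>\<open>True\<close> is red and \<open>False\<close> is blue. The direction from
  \<open>x\<close> to \<open>y\<close> belongs to the red fan of \<open>x\<close> and to the blue
  fan of \<open>y\<close>, which makes it a contact.\<close>

definition fan :: "(real^3) set \<Rightarrow> bool \<Rightarrow> real^3 \<Rightarrow> (real^3) set" where
  "fan V c x = (if c then (\<lambda>y. y - x) else (\<lambda>y. x - y)) ` {y \<in> V. dist x y = 1}"

definition directions :: "(real^3) set \<Rightarrow> (real^3) set" where
  "directions V = (\<Union>x\<in>V. fan V True x)"

text \<open>By \<open>fan_unique\<close> the union has a single member when \<open>p\<close> is a
  direction.\<close>

definition fan_of :: "(real^3) set \<Rightarrow> bool \<Rightarrow> real^3 \<Rightarrow> (real^3) set" where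
  "fan_of V c p = (\<Union>x\<in>{x \<in> V. p \<in> fan V c x}. fan V c x)"

lemma fan_uminus: "uminus ` fan V c x = fan V (\<not> c) x"
  unfolding fan_def image_image by simp

lemma fan_unit: "p \<in> fan V c x \<Longrightarrow> norm p = 1"
  unfolding fan_def by (auto simp: dist_norm norm_minus_commute split: if_splits)

lemma fanTrueE:
  assumes "p \<in> fan V True x"
  obtains y where "y \<in> V" "dist x y = 1" "p = y - x"
  using assms unfolding fan_def by auto

lemma inner_diff_ge:
  fixes x y w :: "real^3"
  assumes "dist x y = 1" "dist w y \<le> 1"
  shows "(y - x) \<bullet> (w - x) \<ge> (norm (w - x))\<^sup>2 / 2"
proof -
  have "(norm (y - w))\<^sup>2 \<le> 1" "(norm (y - x))\<^sup>2 = 1"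
    using assms by (auto simp: dist_norm norm_minus_commute power_le_one)
  moreover have "(norm (y - w))\<^sup>2 = (norm (y - x))\<^sup>2 - 2 * ((y - x) \<bullet> (w - x)) + (norm (w - x))\<^sup>2"
    unfolding power2_norm_eq_inner by (simp add: algebra_simps inner_commute)
  ultimately show ?thesis by simp
qed

locale unit_diameter =
  fixes V :: "(real^3) set"
  assumes finite_V: "finite V"
    and dist_le: "\<lbrakk>x \<in> V; y \<in> V\<rbrakk> \<Longrightarrow> dist x y \<le> 1"
begin

lemma fan_inner_ge:
  assumes "x \<in> V" "w \<in> V" "p \<in> fan V True x"
  shows "p \<bullet> (w - x) \<ge> (norm (w - x))\<^sup>2 / 2"
  using assms inner_diff_ge dist_le by (metis fanTrueE)

lemma fan_combo_uminus:
  "v \<in> nonneg_combos (fan V c x) \<Longrightarrow> - v \<in> nonneg_combos (fan V (\<not> c) x)"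
  using nonneg_combos_uminus fan_uminus by metis

text \<open>Red directions at \<open>x\<close> have positive inner product with
  \<open>x' - x\<close>, those at \<open>x'\<close> negative. A common vector thus has weight 0.
  Blue fans follow by negation.\<close>

lemma fans_disjoint:
  assumes x: "x \<in> V" "x' \<in> V" and v: "v \<in> nonneg_combos (fan V c x)" "v \<in> nonneg_combos (fan V c x')"
    and "v \<noteq> 0"
  shows "x = x'"
proof -
  have main: "x = x'" if v: "v \<in> nonneg_combos (fan V True x)" "v \<in> nonneg_combos (fan V True x')"
    and v0: "v \<noteq> 0" for v
  proof (rule ccontr)
    assume "x \<noteq> x'"
    then have d: "(norm (x' - x))\<^sup>2 / 2 > 0" by simp
    obtain w where w: "w \<ge> 0" "\<And>d k. (\<And>a. a \<in> fan V True x \<Longrightarrow> a \<bullet> d \<ge> k) \<Longrightarrow> v \<bullet> d \<ge> w * k"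
      "\<And>d k. (\<And>a. a \<in> fan V True x \<Longrightarrow> a \<bullet> d \<le> k) \<Longrightarrow> v \<bullet> d \<le> w * k"
      using nonneg_combos_weight[OF v(1)] by metis
    obtain w' where w': "w' \<ge> 0" "\<And>d k. (\<And>a. a \<in> fan V True x' \<Longrightarrow> a \<bullet> d \<ge> k) \<Longrightarrow> v \<bullet> d \<ge> w' * k"
      using nonneg_combos_weight[OF v(2)] by metis
    have "v \<bullet> (x' - x) \<ge> w * ((norm (x' - x))\<^sup>2 / 2)"
      by (intro w(2) fan_inner_ge x)
    moreover have "v \<bullet> (x - x') \<ge> w' * ((norm (x - x'))\<^sup>2 / 2)"
      by (intro w'(2) fan_inner_ge x)
    moreover have "v \<bullet> (x - x') = - (v \<bullet> (x' - x))" by (simp add: inner_diff_right)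
    moreover have "w' * ((norm (x - x'))\<^sup>2 / 2) \<ge> 0" using w'(1) by simp
    ultimately have "w * ((norm (x' - x))\<^sup>2 / 2) \<le> 0" by linarith
    then have "w = 0" using w(1) d by (auto simp: mult_le_0_iff)
    moreover have "v \<bullet> v \<le> w * norm v"
    proof (rule w(3))
      show "a \<bullet> v \<le> norm v" if "a \<in> fan V True x" for a
        using norm_cauchy_schwarz[of a v] fan_unit[OF that] by simp
    qed
    moreover have "v \<bullet> v > 0" using v0 by simp
    ultimately show False by simp
  qed
  show ?thesis
  proof (cases c)
    case True
    then show ?thesis using main assms by auto
  next
    case False
    then show ?thesis using main[of "- v"] fan_combo_uminus[of v c] assms by auto
  qed
qed

text \<open>The distance bounds between neighbours of \<open>x\<close> and neighbours of
  \<open>y\<close> are averaged with the weights of both representations of \<open>v\<close>. The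
  result forces equality in the Cauchy-Schwarz inequality.\<close>

lemma opposite_fans:
  assumes x: "x \<in> V" "y \<in> V" and v: "v \<in> nonneg_combos (fan V True x)" "v \<in> nonneg_combos (fan V False y)"
    and v0: "v \<noteq> 0"
  shows "dist x y = 1" "v = norm v *\<^sub>R (y - x)"
proof -
  define d where "d = y - x"
  obtain m where m: "m \<ge> 0" "\<And>e k. (\<And>a. a \<in> fan V True x \<Longrightarrow> a \<bullet> e \<le> k) \<Longrightarrow> v \<bullet> e \<le> m * k"
    using nonneg_combos_weight[OF v(1)] by metis
  obtain l where l: "l \<ge> 0" "\<And>e k. (\<And>a. a \<in> fan V False y \<Longrightarrow> a \<bullet> e \<le> k) \<Longrightarrow> v \<bullet> e \<le> l * k"
    using nonneg_combos_weight[OF v(2)] by metis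
  have vpos: "norm v > 0" using v0 by simp
  have "v \<bullet> v \<le> m * norm v"
    using norm_cauchy_schwarz[of _ v] fan_unit by (intro m(2)) (metis mult_1)
  then have tm: "norm v \<le> m"
    using vpos by (simp add: dot_square_norm power2_eq_square)
  have "v \<bullet> v \<le> l * norm v"
    using norm_cauchy_schwarz[of _ v] fan_unit by (intro l(2)) (metis mult_1)
  then have tl: "norm v \<le> l"
    using vpos by (simp add: dot_square_norm power2_eq_square)
  define h where "h = ((norm d)\<^sup>2 + 1) / 2"
  \<comment> \<open>This expands the distance bound for the neighbours \<open>x + a\<close> and
    \<open>y - b\<close>. It is affine in \<open>a\<close> and in \<open>b\<close>, so it can be
    averaged over each in turn.\<close>
  have pair: "a \<bullet> b - a \<bullet> d - b \<bullet> d + h \<le> 0" if ab: "a \<in> fan V True x" "b \<in> fan V False y" for a b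
  proof -
    obtain z where z: "z \<in> V" "a = z - x" using fanTrueE[OF ab(1)] by metis
    obtain w where w: "w \<in> V" "b = y - w" using ab(2) unfolding fan_def by auto
    have "norm (a + b - d) \<le> 1" using dist_le[OF z(1) w(1)] z w by (simp add: d_def dist_norm)
    then have "(norm (a + b - d))\<^sup>2 \<le> 1" by (simp add: power_le_one)
    moreover have "(norm a)\<^sup>2 = 1" "(norm b)\<^sup>2 = 1" using ab fan_unit by auto
    moreover have "(norm (a + b - d))\<^sup>2 = (norm a)\<^sup>2 + (norm b)\<^sup>2 + (norm d)\<^sup>2
      + 2 * (a \<bullet> b - a \<bullet> d - b \<bullet> d)"
      unfolding power2_norm_eq_inner by (simp add: algebra_simps inner_commute)
    ultimately show ?thesis unfolding h_def by (simp add: field_simps)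
  qed
  have "v \<bullet> (b - d) \<le> m * (b \<bullet> d - h)" if "b \<in> fan V False y" for b
    using pair[OF _ that] by (intro m(2)) (force simp: inner_diff_right)
  then have "b \<bullet> (v - m *\<^sub>R d) \<le> v \<bullet> d - m * h" if "b \<in> fan V False y" for b
    using that by (fastforce simp: inner_diff_right inner_commute algebra_simps)
  then have "v \<bullet> (v - m *\<^sub>R d) \<le> l * (v \<bullet> d - m * h)" by (rule l(2))
  then have key: "(norm v)\<^sup>2 + l * m * h \<le> (l + m) * (v \<bullet> d)"
    by (simp add: inner_diff_right power2_norm_eq_inner algebra_simps)
  have d1: "norm d \<le> 1" using dist_le[OF x] by (simp add: d_def dist_norm norm_minus_commute)
  have "norm d \<le> h" using zero_le_power2[of "norm d - 1"] unfolding h_def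
    by (simp add: power2_eq_square field_simps)
  have h1: "h \<le> 1" using power_le_one[OF norm_ge_zero d1, of 2] unfolding h_def by simp
  have "v \<bullet> d \<le> norm v * norm d" by (rule norm_cauchy_schwarz)
  also have "\<dots> \<le> norm v * h" using \<open>norm d \<le> h\<close> by (simp add: mult_left_mono)
  finally have "(l + m) * (v \<bullet> d) \<le> (l + m) * (norm v * h)"
    using m(1) l(1) by (intro mult_left_mono) auto
  \<comment> \<open>Both summands are nonnegative, as \<open>l\<close> and \<open>m\<close> are at
    least \<open>norm v\<close> and \<open>h\<close> is at most 1. So \<open>h = 1\<close>, and
    \<open>d\<close> is a unit vector.\<close>
  then have "h * ((l - norm v) * (m - norm v)) + (norm v)\<^sup>2 * (1 - h) \<le> 0"
    using key by (simp add: algebra_simps power2_eq_square)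
  moreover have "h * ((l - norm v) * (m - norm v)) \<ge> 0" using tm tl unfolding h_def by simp
  ultimately have "(norm v)\<^sup>2 * (1 - h) \<le> 0" by linarith
  then have "h = 1" using vpos h1 by (simp add: mult_le_0_iff)
  then have "(norm d)\<^sup>2 = 1" unfolding h_def by simp
  then have nd: "norm d = 1" using norm_ge_zero[of d] by (auto simp: power2_eq_1_iff)
  then show "dist x y = 1" by (simp add: d_def dist_norm norm_minus_commute)
  have "(l - norm v) * (m - norm v) \<ge> 0" using tm tl by simp
  then have "(l + m) * norm v \<le> (l + m) * (v \<bullet> d)"
    using key \<open>h = 1\<close> by (simp add: algebra_simps power2_eq_square)
  moreover have "l + m > 0" using tm tl vpos by linarith
  ultimately have "v \<bullet> d = norm v * norm d"
    using norm_cauchy_schwarz[of v d] nd by simp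
  then show "v = norm v *\<^sub>R (y - x)" using nd norm_cauchy_schwarz_eq[of v d] unfolding d_def by simp
qed

text \<open>The second neighbour \<open>w\<close> of \<open>y\<close> gives a functional
  \<open>w - x\<close> that is minimal on the fan at \<open>y - x\<close>, whence \<open>k\<close>
  is at least the total weight. The inner product with \<open>y - x\<close> shows that it is
  smaller.\<close>

lemma fan_extreme:
  assumes V: "x \<in> V" "y \<in> V" "w \<in> V" "w \<noteq> x" and dist: "dist x y = 1" "dist w y = 1"
    and z: "z \<in> fan V True x" "z \<noteq> y - x" and l: "l > 0" and m: "m \<in> nonneg_combos (fan V True x)"
  shows "l *\<^sub>R z + m \<noteq> k *\<^sub>R (y - x)"
proof
  assume eq: "l *\<^sub>R z + m = k *\<^sub>R (y - x)"
  define p where "p = y - x"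
  define e where "e = (norm (w - x))\<^sup>2 / 2"
  obtain a where a: "a \<ge> 0" "\<And>d k. (\<And>a. a \<in> fan V True x \<Longrightarrow> a \<bullet> d \<ge> k) \<Longrightarrow> m \<bullet> d \<ge> a * k"
    "\<And>d k. (\<And>a. a \<in> fan V True x \<Longrightarrow> a \<bullet> d \<le> k) \<Longrightarrow> m \<bullet> d \<le> a * k"
    using nonneg_combos_weight[OF m] by metis
  have e: "e > 0" using V(4) by (simp add: e_def)
  have np: "norm p = 1" using dist by (simp add: p_def dist_norm norm_minus_commute)
  have nz: "norm z = 1" using z fan_unit by blast
  have "(norm (y - w))\<^sup>2 = 1" using dist by (simp add: dist_norm norm_minus_commute)
  moreover have "(norm (y - w))\<^sup>2 = (norm p)\<^sup>2 - 2 * (p \<bullet> (w - x)) + (norm (w - x))\<^sup>2"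
    unfolding power2_norm_eq_inner p_def by (simp add: algebra_simps inner_commute)
  ultimately have "p \<bullet> (w - x) = e" using np by (simp add: e_def)
  moreover have "l * (z \<bullet> (w - x)) \<ge> l * e"
    using fan_inner_ge[OF V(1,3) z(1)] l by (simp add: e_def)
  moreover have "m \<bullet> (w - x) \<ge> a * e"
    unfolding e_def by (intro a(2) fan_inner_ge V)
  moreover have "l * (z \<bullet> (w - x)) + m \<bullet> (w - x) = k * (p \<bullet> (w - x))"
    using arg_cong[OF eq, of "\<lambda>u. u \<bullet> (w - x)"] by (simp add: inner_add_left p_def)
  ultimately have "(l + a) * e \<le> k * e" by (simp add: algebra_simps)
  then have "l + a \<le> k" using e by simp
  have "z \<bullet> p < 1"
  proof -
    have "(norm (z - p))\<^sup>2 > 0" using z(2) by (simp add: p_def)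
    moreover have "(norm (z - p))\<^sup>2 = (norm z)\<^sup>2 + (norm p)\<^sup>2 - 2 * (z \<bullet> p)"
      unfolding power2_norm_eq_inner by (simp add: algebra_simps inner_commute)
    ultimately show ?thesis using nz np by simp
  qed
  then have "l * (z \<bullet> p) < l" using l by simp
  moreover have "m \<bullet> p \<le> a * 1"
  proof (rule a(3))
    show "u \<bullet> p \<le> 1" if "u \<in> fan V True x" for u
      using norm_cauchy_schwarz[of u p] fan_unit[OF that] np by simp
  qed
  moreover have "l * (z \<bullet> p) + m \<bullet> p = k * (p \<bullet> p)"
    using arg_cong[OF eq, of "\<lambda>u. u \<bullet> p"] by (simp add: inner_add_left p_def)
  moreover have "p \<bullet> p = 1" using np by (simp add: dot_square_norm)
  ultimately show False using \<open>l + a \<le> k\<close> by simp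
qed

lemma finite_fan: "finite (fan V c x)"
  using finite_V unfolding fan_def by simp

lemma fan_combos: "p \<in> fan V c x \<Longrightarrow> p \<in> nonneg_combos (fan V c x)"
  using finite_fan nonneg_combos_member by blast

lemma fan_unique:
  assumes "x \<in> V" "x' \<in> V" "p \<in> fan V c x" "p \<in> fan V c x'"
  shows "x = x'"
proof -
  have "p \<noteq> 0" using fan_unit[OF assms(3)] by auto
  then show ?thesis using fans_disjoint fan_combos assms by blast
qed

lemma fan_of_eq:
  assumes "x \<in> V" "p \<in> fan V c x"
  shows "fan_of V c p = fan V c x"
  using assms fan_unique unfolding fan_of_def by blast

lemma directions_fan:
  assumes "p \<in> directions V"
  obtains x where "x \<in> V" "p \<in> fan V c x"
proof -
  obtain x y where "x \<in> V" "y \<in> V" "dist x y = 1" "p = y - x"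
    using assms unfolding directions_def by (auto elim!: fanTrueE)
  then have "p \<in> fan V True x" "p \<in> fan V False y" unfolding fan_def by (auto simp: dist_commute)
  then show thesis using that \<open>x \<in> V\<close> \<open>y \<in> V\<close> by (cases c) auto
qed

lemma fan_subset_directions: "x \<in> V \<Longrightarrow> fan V c x \<subseteq> directions V"
  unfolding directions_def fan_def by (auto simp: dist_commute image_iff)

lemma finite_directions: "finite (directions V)"
  unfolding directions_def using finite_V finite_fan by blast

lemma card_fan: "card (fan V c x) = card {y \<in> V. dist x y = 1}"
  unfolding fan_def by (intro card_image) (auto simp: inj_on_def)

lemma opposite_fans_common:
  assumes x: "x \<in> V" "y \<in> V" and v: "v \<in> nonneg_combos (fan V c x)" "v \<in> nonneg_combos (fan V (\<not> c) y)"
    and v0: "v \<noteq> 0"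
  shows "\<exists>r\<in>fan V c x \<inter> fan V (\<not> c) y. v = norm v *\<^sub>R r"
proof (cases c)
  case True
  then have "dist x y = 1" "v = norm v *\<^sub>R (y - x)"
    using opposite_fans[OF x _ _ v0] v by auto
  moreover from this have "y - x \<in> fan V c x \<inter> fan V (\<not> c) y"
    using x True unfolding fan_def by (auto simp: dist_commute)
  ultimately show ?thesis by blast
next
  case False
  then have "dist y x = 1" "v = norm v *\<^sub>R (x - y)"
    using opposite_fans[OF x(2,1) _ _ v0] v by auto
  moreover from this have "x - y \<in> fan V c x \<inter> fan V (\<not> c) y"
    using x False unfolding fan_def by (auto simp: dist_commute)
  ultimately show ?thesis by blast
qed

text \<open>Degree 2 yields a second vertex in every fan and the point \<open>w\<close> required by
  \<open>fan_extreme\<close>.\<close>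

lemma arrangementI:
  assumes deg: "\<And>x. x \<in> V \<Longrightarrow> 2 \<le> card {y \<in> V. dist x y = 1}"
    and gen: "\<And>p q. \<lbrakk>p \<in> directions V; q \<in> directions V; det3 p q N = 0\<rbrakk> \<Longrightarrow> q = p \<or> q = - p"
  shows "arrangement 1 N (directions V) (fan_of V)"
proof
  have other: "\<exists>w\<in>V. dist x w = 1 \<and> w \<noteq> y" if x: "x \<in> V" for x y
  proof (rule ccontr)
    assume "\<not> ?thesis"
    then have "{w \<in> V. dist x w = 1} \<subseteq> {y}" by auto
    then have "card {w \<in> V. dist x w = 1} \<le> card {y}" by (intro card_mono) auto
    then show False using deg[OF x] by simp
  qed
  have extr: "l *\<^sub>R z + m \<noteq> k *\<^sub>R p"
    if x: "x \<in> V" and p: "p \<in> fan V True x" and z: "z \<in> fan V True x" "z \<noteq> p" and l: "l > 0"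
      and m: "m \<in> nonneg_combos (fan V True x)" for x p z l m k
  proof -
    obtain y where y: "y \<in> V" "dist x y = 1" "p = y - x" using fanTrueE[OF p] by metis
    obtain w where w: "w \<in> V" "dist y w = 1" "w \<noteq> x" using other[OF y(1)] by blast
    show ?thesis
      using fan_extreme[OF x y(1) w(1,3) y(2) _ z(1) _ l m] w(2) z(2) y(3) by (simp add: dist_commute)
  qed
  show "finite (directions V)" by (rule finite_directions)
  show "q = p \<or> q = - p" if "p \<in> directions V" "q \<in> directions V" "dt 1 p q N = 0" for p q
    using gen that by (simp add: dt_def)
  fix p c assume p: "p \<in> directions V"
  obtain x where x: "x \<in> V" "p \<in> fan V c x" using directions_fan[OF p] by metis
  obtain y where y: "y \<in> V" "p \<in> fan V (\<not> c) y" using directions_fan[OF p] by metis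
  note fx = fan_of_eq[OF x] and fy = fan_of_eq[OF y]
  show "fan_of V c p \<subseteq> directions V" using fx fan_subset_directions x by simp
  show "p \<in> fan_of V c p" using fx x by simp
  show "fan_of V c z = fan_of V c p" if "z \<in> fan_of V c p" for z
    using that fx fan_of_eq x by simp
  show "z = p" if z: "z \<in> fan_of V c p" "z \<in> fan_of V (\<not> c) p" for z
  proof -
    have *: "u = norm u *\<^sub>R (if c then y - x else x - y)"
      if u: "u \<in> fan V c x" "u \<in> fan V (\<not> c) y" for u
    proof -
      have "u \<noteq> 0" using fan_unit[OF u(1)] by auto
      then show ?thesis
        using opposite_fans(2)[OF x(1) y(1), of u] opposite_fans(2)[OF y(1) x(1), of u]
          fan_combos[OF u(1)] fan_combos[OF u(2)] by (cases c) auto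
    qed
    show ?thesis
      using *[of z] *[of p] z x y fx fy fan_unit[of z V c x] fan_unit[OF x(2)] by simp
  qed
  show "\<exists>z\<in>fan_of V c p. z \<noteq> p"
  proof (rule ccontr)
    assume "\<not> ?thesis"
    then have "fan V c x \<subseteq> {p}" using fx by auto
    then have "card (fan V c x) \<le> card {p}" by (intro card_mono) auto
    then show False using deg[OF x(1)] card_fan by simp
  qed
  show "fan_of V c p = fan_of V c q"
    if q: "q \<in> directions V" and v: "v \<in> nonneg_combos (fan_of V c p)" "v \<in> nonneg_combos (fan_of V c q)"
      "v \<noteq> 0" for q v
  proof -
    obtain u where u: "u \<in> V" "q \<in> fan V c u" using directions_fan[OF q] by metis
    show ?thesis using fans_disjoint[OF x(1) u(1), of v c] v fx fan_of_eq[OF u] by simp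
  qed
  show "\<exists>r\<in>fan_of V c p \<inter> fan_of V (\<not> c) q. \<exists>k. v = k *\<^sub>R r"
    if q: "q \<in> directions V" and v: "v \<in> nonneg_combos (fan_of V c p)"
      "v \<in> nonneg_combos (fan_of V (\<not> c) q)" "v \<noteq> 0" for q v
  proof -
    obtain u where u: "u \<in> V" "q \<in> fan V (\<not> c) u" using directions_fan[OF q] by metis
    show ?thesis using opposite_fans_common[OF x(1) u(1), of v c] v fx fan_of_eq[OF u] by auto
  qed
  show False if z: "z \<in> fan_of V c p" "z \<noteq> p" "0 < l" "m \<in> nonneg_combos (fan_of V c p)"
    "l *\<^sub>R z + m = k *\<^sub>R p" for z l m k
  proof (cases c)
    case True
    then show ?thesis using extr[OF x(1), of p z l m k] x z fx by simp
  next
    case False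
    have "- p \<in> fan V True x" "- z \<in> fan V True x"
      using x(2) z(1) fx False fan_uminus[of V False x] by auto
    moreover have "- m \<in> nonneg_combos (fan V True x)"
      using fan_combo_uminus[of m False x] z(4) fx False by simp
    moreover have "l *\<^sub>R (- z) + (- m) = k *\<^sub>R (- p)"
      using arg_cong[OF z(5), of uminus] by simp
    ultimately show ?thesis using extr[OF x(1), of "- p" "- z" l "- m" k] z by simp
  qed
qed

lemma exists_generic:
  "\<exists>N. \<forall>p\<in>directions V. \<forall>q\<in>directions V. det3 p q N = 0 \<longrightarrow> q = p \<or> q = - p"
proof -
  define A :: "(real^3) set" where "A = {vector [1, 0, 0], vector [0, 1, 0], vector [0, 0, 1]}"
  define Q where "Q = {(p, q). p \<in> directions V \<and> q \<in> directions V \<and> q \<noteq> p \<and> q \<noteq> - p}"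
  have "Q \<subseteq> directions V \<times> directions V" unfolding Q_def by auto
  then have Q: "finite Q" by (rule finite_subset) (simp add: finite_directions)
  have A: "finite A" unfolding A_def by simp
  have nz: "\<exists>z\<in>A. det3 p q z \<noteq> 0" if pq: "(p, q) \<in> Q" for p q
  proof (rule ccontr)
    assume "\<not> ?thesis"
    then have "p$2 * q$3 - p$3 * q$2 = 0" "p$1 * q$3 - p$3 * q$1 = 0" "p$1 * q$2 - p$2 * q$1 = 0"
      unfolding A_def det3_def by (simp_all add: vector_3)
    \<comment> \<open>Lagrange's identity: a vanishing cross product of unit vectors makes them
      equal or opposite.\<close>
    moreover have "(p \<bullet> q)\<^sup>2 + (p$2 * q$3 - p$3 * q$2)\<^sup>2 + (p$1 * q$3 - p$3 * q$1)\<^sup>2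
      + (p$1 * q$2 - p$2 * q$1)\<^sup>2 = (p \<bullet> p) * (q \<bullet> q)"
      by (simp add: inner_vec_def sum_3 power2_eq_square algebra_simps)
    ultimately have eq: "(p \<bullet> q)\<^sup>2 = (p \<bullet> p) * (q \<bullet> q)" by simp
    have "norm p = 1" "norm q = 1"
      using pq fan_unit unfolding Q_def directions_def by auto
    then have pp: "p \<bullet> p = 1" "q \<bullet> q = 1" by (simp_all add: dot_square_norm)
    then have "(p \<bullet> q)\<^sup>2 = 1" using eq by simp
    then have pq1: "p \<bullet> q = 1 \<or> p \<bullet> q = - 1" by (simp add: power2_eq_1_iff)
    have "(q - p) \<bullet> (q - p) = 2 - 2 * (p \<bullet> q)" "(q + p) \<bullet> (q + p) = 2 + 2 * (p \<bullet> q)"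
      using pp by (simp_all add: inner_diff_left inner_diff_right inner_add_left inner_add_right inner_commute)
    then have "q - p = 0 \<or> q + p = 0" using pq1 by (metis inner_eq_zero_iff mult.right_neutral diff_self
          mult_minus_right add.right_inverse)
    then show False using pq unfolding Q_def by (auto simp: eq_neg_iff_add_eq_0)
  qed
  obtain f where "\<And>z. f z > 0"
    and f: "\<And>p q. (p, q) \<in> Q \<Longrightarrow> det3 p q (\<Sum>z\<in>A. f z *\<^sub>R z) \<noteq> 0"
    using generic_positive_combo[OF A Q nz] by blast
  show ?thesis
    by (intro exI[of _ "\<Sum>z\<in>A. f z *\<^sub>R z"]) (use f in \<open>auto simp: Q_def\<close>)
qed

lemma exists_generic_inside:
  assumes deg: "\<And>x. x \<in> V \<Longrightarrow> 3 \<le> card {y \<in> V. dist x y = 1}" and x: "x \<in> V"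
  obtains f where "\<And>z. f z > 0"
    "arrangement 1 (\<Sum>z\<in>fan V True x. f z *\<^sub>R z) (directions V) (fan_of V)"
proof -
  have deg2: "2 \<le> card {y \<in> V. dist x y = 1}" if "x \<in> V" for x
    using deg[OF that] by simp
  obtain N where N: "\<And>p q. \<lbrakk>p \<in> directions V; q \<in> directions V; det3 p q N = 0\<rbrakk> \<Longrightarrow> q = p \<or> q = - p"
    using exists_generic by blast
  \<comment> \<open>A preliminary pole, in arbitrary generic position, gives access to
    \<open>dt_cls_nonzero\<close>: three directions at \<open>x\<close> are independent. The final
    pole can then be chosen inside the fan of \<open>x\<close>.\<close>
  interpret A: arrangement 1 N "directions V" "fan_of V"
    using deg2 N by (rule arrangementI)
  obtain T where "T \<subseteq> fan V True x" "card T = 3"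
    using deg[OF x] card_fan[of True x] obtain_subset_with_card_n by metis
  then obtain a b c where abc: "a \<in> fan V True x" "b \<in> fan V True x" "c \<in> fan V True x"
    "a \<noteq> b" "a \<noteq> c" "b \<noteq> c"
    by (auto simp: card_3_iff)
  have "dt 1 a b c \<noteq> 0"
    using A.dt_cls_nonzero[of a b True c] fan_of_eq[OF x abc(1)] abc fan_subset_directions[OF x] by blast
  then have det: "det3 a b c \<noteq> 0" by (simp add: dt_def)
  define Q where "Q = {(p, q). p \<in> directions V \<and> q \<in> directions V \<and> q \<noteq> p \<and> q \<noteq> - p}"
  have "Q \<subseteq> directions V \<times> directions V" unfolding Q_def by auto
  then have Q: "finite Q" by (rule finite_subset) (simp add: finite_directions)
  have nz: "\<exists>z\<in>fan V True x. det3 p q z \<noteq> 0" if pq: "(p, q) \<in> Q" for p q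
  proof (rule ccontr)
    assume "\<not> ?thesis"
    then have "dt 1 p q a = 0" "dt 1 p q b = 0" "dt 1 p q c = 0" using abc by (auto simp: dt_def)
    then have "dt 1 a b c * dt 1 p q N = 0"
      using arg_cong[OF dt_cramer[of 1 a b c N], of "dt 1 p q"] by (simp add: dt_add dt_scaleR)
    then have "det3 p q N = 0" using det by (simp add: dt_def)
    then show False using N pq unfolding Q_def by blast
  qed
  obtain f where f: "\<And>z. f z > 0"
    "\<And>p q. (p, q) \<in> Q \<Longrightarrow> det3 p q (\<Sum>z\<in>fan V True x. f z *\<^sub>R z) \<noteq> 0"
    using generic_positive_combo[OF finite_fan Q nz] by blast
  have "arrangement 1 (\<Sum>z\<in>fan V True x. f z *\<^sub>R z) (directions V) (fan_of V)"
    using f(2) by (intro arrangementI deg2) (auto simp: Q_def)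
  then show thesis using that f(1) by blast
qed

text \<open>Each fan has at most one rightmost and one leftmost vertex, and the fans of
  \<open>x\<close> have none, since they surround the poles. Two colours and two sides give the
  factor 4.\<close>

lemma card_directions_le:
  assumes deg: "\<And>x. x \<in> V \<Longrightarrow> 3 \<le> card {y \<in> V. dist x y = 1}" and x: "x \<in> V"
  shows "card (directions V) \<le> 4 * (card V - 1)"
proof -
  obtain f where f: "\<And>z. f z > 0"
    and arr: "arrangement 1 (\<Sum>z\<in>fan V True x. f z *\<^sub>R z) (directions V) (fan_of V)"
    using exists_generic_inside[OF deg x] by metis
  define N where "N = (\<Sum>z\<in>fan V True x. f z *\<^sub>R z)"
  interpret A: arrangement 1 N "directions V" "fan_of V" using arr N_def by simp
  have N': "- N = (\<Sum>z\<in>fan V False x. f (- z) *\<^sub>R z)"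
    unfolding N_def fan_uminus[of V True x, simplified, symmetric]
    by (subst sum.reindex) (auto simp: sum_negf)
  have le: "card {p \<in> directions V. \<not> right_nbr s N (fan_of V) c p} \<le> card V - 1"
    if s: "arrangement s N (directions V) (fan_of V)" for s c
  proof -
    interpret B: arrangement s N "directions V" "fan_of V" by (rule s)
    define X where "X y = {p \<in> fan V c y. \<not> right_nbr s N (fan_of V) c p}" for y
    have "{p \<in> directions V. \<not> right_nbr s N (fan_of V) c p} \<subseteq> (\<Union>y\<in>V - {x}. X y)"
    proof
      fix p assume "p \<in> {p \<in> directions V. \<not> right_nbr s N (fan_of V) c p}"
      then have p: "p \<in> directions V" "\<not> right_nbr s N (fan_of V) c p" by auto
      obtain y where y: "y \<in> V" "p \<in> fan V c y" using directions_fan[OF p(1)] by metis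
      have "y \<noteq> x"
      proof
        assume "y = x"
        then have "fan_of V c p = fan V c x" using fan_of_eq y by simp
        then show False
          using B.right_nbr_surrounded[OF p(1), of f 1 c] B.right_nbr_surrounded[OF p(1), of "\<lambda>z. f (- z)" "- 1" c]
            f N' p(2) by (cases c) (auto simp: N_def)
      qed
      then show "p \<in> (\<Union>y\<in>V - {x}. X y)" using y p(2) unfolding X_def by blast
    qed
    moreover have "finite (X y)" for y unfolding X_def using finite_fan by simp
    ultimately have "card {p \<in> directions V. \<not> right_nbr s N (fan_of V) c p} \<le> card (\<Union>y\<in>V - {x}. X y)"
      using finite_V by (intro card_mono) auto
    also have "\<dots> \<le> (\<Sum>y\<in>V - {x}. card (X y))"
      using finite_V by (intro card_UN_le) auto
    also have "\<dots> \<le> (\<Sum>y\<in>V - {x}. 1)"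
    proof (rule sum_mono)
      fix y assume y: "y \<in> V - {x}"
      have "p = q" if "p \<in> X y" "q \<in> X y" for p q
        using that y fan_of_eq[of y p c] fan_subset_directions[of y c] B.right_extreme_unique[of p q c]
        unfolding X_def by auto
      then show "card (X y) \<le> 1" using \<open>finite (X y)\<close> by (simp add: card_le_Suc0_iff_eq)
    qed
    also have "\<dots> = card V - 1" using x finite_V by simp
    finally show ?thesis .
  qed
  have "card (directions V) \<le> (\<Sum>c\<in>UNIV. card {p \<in> directions V. \<not> right_nbr 1 N (fan_of V) c p}
      + card {p \<in> directions V. \<not> right_nbr (- 1) N (fan_of V) c p})"
    by (rule A.card_le_extremes)
  also have "\<dots> \<le> (\<Sum>c\<in>(UNIV :: bool set). (card V - 1) + (card V - 1))"
    by (intro sum_mono add_mono le A.arrangement_axioms A.flip_horizontal)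
  also have "\<dots> = 4 * (card V - 1)" by simp
  finally show ?thesis .
qed

end

section \<open>From directions to edges, deletion of points of small degree, and scaling\<close>

definition unit_edges :: "(real^3) set \<Rightarrow> (real^3) set set" where
  "unit_edges V = {{x, y} | x y. x \<in> V \<and> y \<in> V \<and> dist x y = 1}"

lemma finite_unit_edges: "finite V \<Longrightarrow> finite (unit_edges V)"
  by (rule finite_subset[of _ "Pow V"]) (auto simp: unit_edges_def)

context unit_diameter
begin

text \<open>An edge has two opposite directions, and a direction determines its tail by
  \<open>fan_unique\<close>, hence its edge.\<close>

lemma card_unit_edges_le_directions: "2 * card (unit_edges V) \<le> card (directions V)"
proof -
  define D where "D e = {y - x | x y. e = {x, y} \<and> dist x y = 1}" for e :: "(real^3) set"
  have D: "D {x, y} = {y - x, x - y}" if xy: "dist x y = 1" for x y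
  proof
    show "D {x, y} \<subseteq> {y - x, x - y}" unfolding D_def by (auto simp: doubleton_eq_iff)
    have "\<exists>a b. x - y = b - a \<and> {x, y} = {a, b} \<and> dist a b = 1"
      by (intro exI[of _ y] exI[of _ x]) (use xy in \<open>auto simp: dist_commute\<close>)
    then show "{y - x, x - y} \<subseteq> D {x, y}" using xy unfolding D_def by auto
  qed
  have card: "card (D e) = 2" and sub: "D e \<subseteq> directions V" if e: "e \<in> unit_edges V" for e
  proof -
    obtain x y where xy: "x \<in> V" "y \<in> V" "dist x y = 1" "e = {x, y}"
      using e unfolding unit_edges_def by blast
    have "y - x \<noteq> x - y"
    proof
      assume "y - x = x - y"
      then have "2 *\<^sub>R (y - x) = 0" by (simp add: scaleR_2 algebra_simps)
      then show False using xy(3) by simp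
    qed
    then show "card (D e) = 2" using D[OF xy(3)] xy(4) by simp
    have "y - x \<in> fan V True x" "x - y \<in> fan V True y"
      using xy unfolding fan_def by (auto simp: dist_commute)
    then show "D e \<subseteq> directions V"
      unfolding xy(4) D[OF xy(3)] directions_def using xy(1,2) by blast
  qed
  have disj: "D e \<inter> D e' = {}" if e: "e \<in> unit_edges V" "e' \<in> unit_edges V" "e \<noteq> e'" for e e'
  proof (rule ccontr)
    assume "D e \<inter> D e' \<noteq> {}"
    then obtain p where p: "p \<in> D e" "p \<in> D e'" by blast
    then obtain x y u v where xy: "e = {x, y}" "dist x y = 1" "p = y - x" "e' = {u, v}" "dist u v = 1" "p = v - u"
      unfolding D_def by blast
    then have V: "x \<in> V" "y \<in> V" "u \<in> V" "v \<in> V"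
      using e unfolding unit_edges_def by (auto simp: doubleton_eq_iff)
    have "y - x \<in> fan V True x" "v - u \<in> fan V True u" using xy(2,5) V unfolding fan_def by auto
    then have "p \<in> fan V True x" "p \<in> fan V True u" using xy by simp_all
    then have "x = u" using fan_unique V by blast
    then show False using xy e(3) by simp
  qed
  have "2 * card (unit_edges V) = (\<Sum>e\<in>unit_edges V. card (D e))" using card by simp
  also have "\<dots> = card (\<Union>e\<in>unit_edges V. D e)"
    using disj finite_unit_edges[OF finite_V] finite_subset[OF sub finite_directions]
    by (intro card_UN_disjoint[symmetric]) auto
  also have "\<dots> \<le> card (directions V)"
    using sub finite_directions by (intro card_mono) auto
  finally show ?thesis .
qed

end

text \<open>Deleting a point of degree at most 2 lowers the bound by exactly 2. At four points
  deletion stops, and the bound 6 is the number of all pairs.\<close>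

lemma card_unit_edges_le:
  assumes "finite V" "4 \<le> card V" "\<And>x y. \<lbrakk>x \<in> V; y \<in> V\<rbrakk> \<Longrightarrow> dist x y \<le> 1"
  shows "card (unit_edges V) \<le> 2 * card V - 2"
  using assms
proof (induction "card V" arbitrary: V rule: less_induct)
  case less
  interpret unit_diameter V using less.prems by unfold_locales auto
  have "V \<noteq> {}" using less.prems by auto
  show ?case
  proof (cases "\<forall>x\<in>V. 3 \<le> card {y \<in> V. dist x y = 1}")
    case True
    then have "card (directions V) \<le> 4 * (card V - 1)"
      using card_directions_le \<open>V \<noteq> {}\<close> by blast
    then show ?thesis using card_unit_edges_le_directions by simp
  next
    case False
    then obtain x where x: "x \<in> V" "card {y \<in> V. dist x y = 1} \<le> 2" by fastforce
    show ?thesis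
    proof (cases "card V = 4")
      case True
      have "unit_edges V \<subseteq> {e. e \<subseteq> V \<and> card e = 2}"
        unfolding unit_edges_def by (auto simp: card_insert_if)
      then have "card (unit_edges V) \<le> card {e. e \<subseteq> V \<and> card e = 2}"
        using less.prems(1) by (intro card_mono) auto
      also have "\<dots> = 4 choose 2" using n_subsets[OF less.prems(1), of 2] True by simp
      also have "\<dots> = 6" by (simp add: eval_nat_numeral)
      finally show ?thesis using True by simp
    next
      case False
      have card: "card (V - {x}) = card V - 1" using x less.prems(1) by simp
      have IH: "card (unit_edges (V - {x})) \<le> 2 * card (V - {x}) - 2"
        using less.prems False card x(1) by (intro less.hyps) auto
      have "unit_edges V \<subseteq> unit_edges (V - {x}) \<union> (\<lambda>y. {x, y}) ` {y \<in> V. dist x y = 1}"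
      proof
        fix e assume "e \<in> unit_edges V"
        then obtain a b where e: "e = {a, b}" "a \<in> V" "b \<in> V" "dist a b = 1"
          unfolding unit_edges_def by blast
        consider "a = x" | "b = x" | "a \<noteq> x" "b \<noteq> x" by blast
        then show "e \<in> unit_edges (V - {x}) \<union> (\<lambda>y. {x, y}) ` {y \<in> V. dist x y = 1}"
        proof cases
          case 2
          then have "e = {x, a}" "dist x a = 1" using e by (auto simp: dist_commute)
          then show ?thesis using e by blast
        qed (use e in \<open>auto simp: unit_edges_def\<close>)
      qed
      then have "card (unit_edges V)
        \<le> card (unit_edges (V - {x}) \<union> (\<lambda>y. {x, y}) ` {y \<in> V. dist x y = 1})"
        using less.prems(1) finite_unit_edges by (intro card_mono) auto
      also have "\<dots> \<le> card (unit_edges (V - {x})) + card ((\<lambda>y. {x, y}) ` {y \<in> V. dist x y = 1})"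
        by (rule card_Un_le)
      also have "\<dots> \<le> card (unit_edges (V - {x})) + card {y \<in> V. dist x y = 1}"
        using less.prems(1) by (intro add_left_mono card_image_le) auto
      finally show ?thesis using IH card x(2) less.prems(2) False by simp
    qed
  qed
qed

theorem theorem1:
  fixes S :: "(real ^ 3) set" and n :: nat
  assumes "n \<ge> 4" and "finite S" and "card S = n"
  shows "card (edges (diameter_graph S)) \<le> 2 * n - 2"
proof -
  have bdd: "bounded S" using assms(2) by (rule finite_imp_bounded)
  obtain a b where ab: "a \<in> S" "b \<in> S" "a \<noteq> b"
    using card_le_Suc0_iff_eq[OF assms(2)] assms(1,3) by force
  define D where "D = diameter S"
  have "0 < dist a b" using ab by simp
  also have "\<dots> \<le> D" unfolding D_def using diameter_bounded_bound[OF bdd] ab by blast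
  finally have D: "D > 0" .
  \<comment> \<open>Scaling by \<open>1 / D\<close> makes the diameter 1; injectivity of
    \<open>g\<close> preserves the number of edges.\<close>
  define g where "g x = (1 / D) *\<^sub>R x" for x :: "real^3"
  have dist_g: "dist (g x) (g y) = dist x y / D" for x y
    using D by (simp add: g_def dist_norm scaleR_diff_right[symmetric])
  have "g ` e \<in> unit_edges (g ` S)" if e: "e \<in> edges (diameter_graph S)" for e
  proof -
    obtain x y where xy: "x \<in> S" "y \<in> S" "dist x y = D" "e = {x, y}"
      using e unfolding diameter_graph_def D_def by auto
    then have "dist (g x) (g y) = 1" using dist_g D by simp
    then show ?thesis using xy unfolding unit_edges_def by blast
  qed
  then have "(`) g ` edges (diameter_graph S) \<subseteq> unit_edges (g ` S)" by blast
  moreover have inj: "inj g" using D by (simp add: g_def inj_on_def)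
  moreover have "finite (unit_edges (g ` S))" using assms(2) by (intro finite_unit_edges) simp
  ultimately have "card (edges (diameter_graph S)) \<le> card (unit_edges (g ` S))"
    by (metis card_image card_mono inj_image_eq_iff inj_onI)
  also have "\<dots> \<le> 2 * card (g ` S) - 2"
  proof (rule card_unit_edges_le)
    show "dist x y \<le> 1" if xy: "x \<in> g ` S" "y \<in> g ` S" for x y
    proof -
      obtain u v where "u \<in> S" "v \<in> S" "x = g u" "y = g v" using xy by blast
      then show ?thesis using diameter_bounded_bound[OF bdd, of u v] D dist_g[of u v] by (simp add: D_def)
    qed
  qed (use assms inj card_image[of g S] inj_on_subset in \<open>auto simp: inj_on_def\<close>)
  also have "card (g ` S) = n" using assms inj by (simp add: card_image inj_on_subset)
  finally show ?thesis .
qed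

end
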